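(* Suppose that $\mathfrak h$ is a six-dimensional non-abelian real nilpotent Lie algebra given as a semi-direct product $\mathfrak g\ltimes_\rho V$ with $\dim\mathfrak g=\dim V=3$. Then $\mathfrak h$ is isomorphic to one of $\mathfrak h_3,\mathfrak h_4,\mathfrak h_6,\mathfrak h_7,\mathfrak h_8,\mathfrak h_9,\mathfrak h_{10},\mathfrak h_{11},\mathfrak h_{17},\mathfrak h_{19}$, and its dual semi-direct product $\mathfrak h^\vee=\mathfrak g\ltimes_{\rho^*}V^*$ is determined up to isomorphism as follows. (a) If $\mathfrak g$ is abelian, then $\mathfrak h$ is isomorphic to one of $\mathfrak h_3,\mathfrak h_6,\mathfrak h_8,\mathfrak h_9,\mathfrak h_{17}$, and $\mathfrak h^\vee$ is isomorphic, respectively, to $\mathfrak h_6,\mathfrak h_3,\mathfrak h_8,\mathfrak h_9,\mathfrak h_{17}$. (b) If $\mathfrak g$ is non-abelian (hence the three-dimensional Heisenberg algebra), then $\mathfrak h$ is isomorphic to one of $\mathfrak h_4,\mathfrak h_6,\mathfrak h_7,\mathfrak h_8,\mathfrak h_{10},\mathfrak h_{11},\mathfrak h_{19}$, and $\mathfrak h^\vee$ is isomorphic, respectively, to $\mathfrak h_7,\mathfrak h_6,\mathfrak h_4,\mathfrak h_8,\mathfrak h_{10},\mathfrak h_{11},\mathfrak h_{19}$.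
   Context: For a Lie algebra $\mathfrak g$ and a representation $\rho:\mathfrak g\to\mathrm{End}(V)$, $\mathfrak g\ltimes_\rho V$ is $\mathfrak g\oplus V$ with bracket $[x+u,y+v]=[x,y]+\rho(x)v-\rho(y)u$ (so $V$ is an abelian ideal). The dual representation is $(\rho^*(x)a)(u)=-a(\rho(x)u)$. A list $(de^1,\dots,de^6)$ denotes the real six-dimensional Lie algebra with a basis $e_1,\dots,e_6$ whose dual basis satisfies these equations, where $ij$ stands for $e^i\wedge e^j$ and $d\alpha(x,y)=-\alpha([x,y])$. Up to isomorphism: $\mathfrak h_3=(0,0,0,0,0,14-23)$; $\mathfrak h_4=(0,0,0,0,13,14-23)$; $\mathfrak h_6=(0,0,0,12,13,0)$; $\mathfrak h_7=(0,0,0,12,13,-23)$; $\mathfrak h_8=(0,0,0,0,0,-23)$; $\mathfrak h_9=(0,0,0,12,0,14-23)$; $\mathfrak h_{10}=(0,0,0,12,13,14)$; $\mathfrak h_{11}=(0,0,0,12,13,14-23)$; $\mathfrak h_{17}=(0,0,0,12,0,14)$; $\mathfrak h_{19}=(0,0,0,12,13,25+34)$ (the real form also denoted $\mathfrak h_{19+}$). *)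

theory Defs
  imports "HOL-Analysis.Analysis" "HOL-Library.Function_Algebras"
begin

text \<open>
  A real Lie algebra is given by its bracket on a type of class \<^class>\<open>real_vector\<close>;
  the underlying vector space is the whole type.
\<close>

definition lie_algebra :: "('g::real_vector \<Rightarrow> 'g \<Rightarrow> 'g) \<Rightarrow> bool" where
  "lie_algebra b \<longleftrightarrow>
     bilinear b \<and>
     (\<forall>x. b x x = 0) \<and>
     (\<forall>x y z. b x (b y z) + b y (b z x) + b z (b x y) = 0)"

definition lie_abelian :: "('g::real_vector \<Rightarrow> 'g \<Rightarrow> 'g) \<Rightarrow> bool" where
  "lie_abelian b \<longleftrightarrow> (\<forall>x y. b x y = 0)"

primrec lower_central :: "('g::real_vector \<Rightarrow> 'g \<Rightarrow> 'g) \<Rightarrow> nat \<Rightarrow> 'g set" where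
  "lower_central b 0 = UNIV"
| "lower_central b (Suc n) = span {b x y | x y. y \<in> lower_central b n}"

definition lie_nilpotent :: "('g::real_vector \<Rightarrow> 'g \<Rightarrow> 'g) \<Rightarrow> bool" where
  "lie_nilpotent b \<longleftrightarrow> (\<exists>n. lower_central b n = {0})"

definition lie_isomorphic ::
  "('g::real_vector \<Rightarrow> 'g \<Rightarrow> 'g) \<Rightarrow> ('h::real_vector \<Rightarrow> 'h \<Rightarrow> 'h) \<Rightarrow> bool" where
  "lie_isomorphic b c \<longleftrightarrow>
     (\<exists>f. linear f \<and> bij f \<and> (\<forall>x y. f (b x y) = c (f x) (f y)))"

text \<open>
  Bilinearity says that every \<open>\<rho> x\<close> is an endomorphism and that \<open>\<rho>\<close> is linear in \<open>x\<close>.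
\<close>

definition lie_representation ::
  "('g::real_vector \<Rightarrow> 'g \<Rightarrow> 'g) \<Rightarrow> ('g \<Rightarrow> 'v::real_vector \<Rightarrow> 'v) \<Rightarrow> bool" where
  "lie_representation b \<rho> \<longleftrightarrow>
     bilinear \<rho> \<and> (\<forall>x y v. \<rho> (b x y) v = \<rho> x (\<rho> y v) - \<rho> y (\<rho> x v))"

definition semidirect ::
  "('g::real_vector \<Rightarrow> 'g \<Rightarrow> 'g) \<Rightarrow> ('g \<Rightarrow> 'v::real_vector \<Rightarrow> 'v) \<Rightarrow> 'g \<times> 'v \<Rightarrow> 'g \<times> 'v \<Rightarrow> 'g \<times> 'v"
  where
  "semidirect b \<rho> = (\<lambda>(x, u) (y, v). (b x y, \<rho> x v - \<rho> y u))"

lemma lie_algebra_semidirect: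
  assumes "lie_algebra b" and "lie_representation b \<rho>"
  shows "lie_algebra (semidirect b \<rho>)"
proof -
  have b: "bilinear b" "\<And>x. b x x = 0"
      "\<And>x y z. b x (b y z) + b y (b z x) + b z (b x y) = 0"
    using assms(1) by (auto simp: lie_algebra_def)
  have r: "bilinear \<rho>" "\<And>x y v. \<rho> (b x y) v = \<rho> x (\<rho> y v) - \<rho> y (\<rho> x v)"
    using assms(2) by (auto simp: lie_representation_def)
  note lb = bilinear_ladd[OF b(1)] bilinear_radd[OF b(1)] bilinear_lmul[OF b(1)] bilinear_rmul[OF b(1)]
  note lr = bilinear_ladd[OF r(1)] bilinear_radd[OF r(1)] bilinear_lmul[OF r(1)] bilinear_rmul[OF r(1)]
    bilinear_lsub[OF r(1)] bilinear_rsub[OF r(1)]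
  have "bilinear (semidirect b \<rho>)"
    unfolding bilinear_def
    by (auto intro!: linearI simp: semidirect_def lb lr algebra_simps)
  then show ?thesis
    unfolding lie_algebra_def by (auto simp: semidirect_def b r lr zero_prod_def)
qed


subsection \<open>The dual representation\<close>

typedef (overloaded) 'v dual = "{a :: 'v::real_vector \<Rightarrow> real. linear a}"
  morphisms dual_apply Dual
  by (rule exI[of _ "\<lambda>_. 0"]) (simp add: linear_zero)

lemma linear_dual_apply: "linear (dual_apply a)"
  using dual_apply[of a] by simp

lemma dual_eqI: "(\<And>u. dual_apply a u = dual_apply c u) \<Longrightarrow> a = c"
  by (simp add: dual_apply_inject[symmetric] fun_eq_iff)

instantiation dual :: (real_vector) real_vector
begin

definition zero_dual :: "'a dual" where "0 = Dual (\<lambda>u. 0)"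
definition plus_dual :: "'a dual \<Rightarrow> 'a dual \<Rightarrow> 'a dual" where
  "a + c = Dual (\<lambda>u. dual_apply a u + dual_apply c u)"
definition minus_dual :: "'a dual \<Rightarrow> 'a dual \<Rightarrow> 'a dual" where
  "a - c = Dual (\<lambda>u. dual_apply a u - dual_apply c u)"
definition uminus_dual :: "'a dual \<Rightarrow> 'a dual" where
  "- a = Dual (\<lambda>u. - dual_apply a u)"
definition scaleR_dual :: "real \<Rightarrow> 'a dual \<Rightarrow> 'a dual" where
  "r *\<^sub>R a = Dual (\<lambda>u. r * dual_apply a u)"

lemma dual_apply_simps:
  "dual_apply 0 u = 0"
  "dual_apply (a + c) u = dual_apply a u + dual_apply c u"
  "dual_apply (a - c) u = dual_apply a u - dual_apply c u"
  "dual_apply (- a) u = - dual_apply a u"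
  "dual_apply (r *\<^sub>R a) u = r * dual_apply a u"
proof -
  note lin = linear_add[OF linear_dual_apply] linear_cmul[OF linear_dual_apply]
  show "dual_apply 0 u = 0" "dual_apply (a + c) u = dual_apply a u + dual_apply c u"
    "dual_apply (a - c) u = dual_apply a u - dual_apply c u"
    "dual_apply (- a) u = - dual_apply a u" "dual_apply (r *\<^sub>R a) u = r * dual_apply a u"
    unfolding zero_dual_def plus_dual_def minus_dual_def uminus_dual_def scaleR_dual_def
    by (subst Dual_inverse; auto intro!: linearI simp: lin algebra_simps)+
qed

instance
  by standard (auto intro!: dual_eqI simp: dual_apply_simps algebra_simps)

end

definition dual_rep :: "('g \<Rightarrow> 'v::real_vector \<Rightarrow> 'v) \<Rightarrow> 'g \<Rightarrow> 'v dual \<Rightarrow> 'v dual" where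
  "dual_rep \<rho> x a = Dual (\<lambda>u. - dual_apply a (\<rho> x u))"

lemma dual_rep_apply:
  assumes "linear (\<rho> x)"
  shows "dual_apply (dual_rep \<rho> x a) u = - dual_apply a (\<rho> x u)"
  unfolding dual_rep_def
  by (subst Dual_inverse)
     (auto intro!: linearI simp: linear_add[OF assms] linear_cmul[OF assms]
        linear_add[OF linear_dual_apply] linear_cmul[OF linear_dual_apply])

lemma lie_representation_dual_rep:
  assumes "lie_representation b \<rho>"
  shows "lie_representation b (dual_rep \<rho>)"
proof -
  have r: "bilinear \<rho>" "\<And>x y v. \<rho> (b x y) v = \<rho> x (\<rho> y v) - \<rho> y (\<rho> x v)"
    using assms by (auto simp: lie_representation_def)
  have lin: "linear (\<rho> x)" for x using r(1) by (simp add: bilinear_def)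
  have l: "\<rho> (x + y) u = \<rho> x u + \<rho> y u" "\<rho> (c *\<^sub>R x) u = c *\<^sub>R \<rho> x u" for x y c u
    using r(1) by (simp_all add: bilinear_ladd bilinear_lmul)
  note d = dual_rep_apply[OF lin] dual_apply_simps l linear_add[OF linear_dual_apply]
     linear_cmul[OF linear_dual_apply] linear_diff[OF linear_dual_apply]
  show ?thesis
    unfolding lie_representation_def bilinear_def
    by (auto intro!: linearI dual_eqI simp: d r(2))
qed


subsection \<open>Lie algebras given by structure equations\<close>

text \<open>\<open>wedge i j\<close> is the 2-form \<open>e\<^sup>i \<and> e\<^sup>j\<close> on \<open>\<real>\<^sup>n\<close>.\<close>

definition wedge :: "'n \<Rightarrow> 'n \<Rightarrow> real ^ 'n::finite \<Rightarrow> real ^ 'n \<Rightarrow> real" where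
  "wedge i j x y = x $ i * y $ j - x $ j * y $ i"

text \<open>
  The Lie bracket on \<open>\<real>\<^sup>n\<close> for which the basis \<open>e\<^sup>1, \<dots>, e\<^sup>n\<close> dual to the standard
  basis has the listed differentials.  The sign comes from the convention
  \<open>d\<alpha>(x, y) = - \<alpha>([x, y])\<close>.  The components are numbered
  \<open>1, \<dots>, n\<close>; in the numeral type \<open>n\<close> the last index \<open>n\<close> equals \<open>0\<close>.
\<close>

definition lie_of_differentials ::
  "((real, 'n) vec \<Rightarrow> (real, 'n) vec \<Rightarrow> real) list \<Rightarrow>
   (real, 'n) vec \<Rightarrow> (real, 'n) vec \<Rightarrow> (real, 'n::{finite, numeral}) vec" where
  "lie_of_differentials ds x y = vector (map (\<lambda>\<omega>. - \<omega> x y) ds)"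

lemma vector_6:
  "(vector [a, b, c, d, e, f] :: 'a::zero ^ 6) $ 1 = a"
  "(vector [a, b, c, d, e, f] :: 'a ^ 6) $ 2 = b"
  "(vector [a, b, c, d, e, f] :: 'a ^ 6) $ 3 = c"
  "(vector [a, b, c, d, e, f] :: 'a ^ 6) $ 4 = d"
  "(vector [a, b, c, d, e, f] :: 'a ^ 6) $ 5 = e"
  "(vector [a, b, c, d, e, f] :: 'a ^ 6) $ 6 = f"
  unfolding vector_def by simp_all

lemma exhaust_6: "i = 1 \<or> i = 2 \<or> i = 3 \<or> i = 4 \<or> i = 5 \<or> i = 6" for i :: 6
proof (induct i)
  case (of_int z)
  then have "z = 0 \<or> z = 1 \<or> z = 2 \<or> z = 3 \<or> z = 4 \<or> z = 5" by fastforce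
  then show ?case by auto
qed

lemma forall_6: "(\<forall>i::6. P i) \<longleftrightarrow> P 1 \<and> P 2 \<and> P 3 \<and> P 4 \<and> P 5 \<and> P 6"
proof safe
  fix i :: 6
  assume "P 1" "P 2" "P 3" "P 4" "P 5" "P 6"
  then show "P i" using exhaust_6[of i] by auto
qed blast+

definition alg_h3 :: "real ^ 6 \<Rightarrow> real ^ 6 \<Rightarrow> real ^ 6" where
  "alg_h3 = lie_of_differentials [0, 0, 0, 0, 0, wedge 1 4 - wedge 2 3]"
definition alg_h4 :: "real ^ 6 \<Rightarrow> real ^ 6 \<Rightarrow> real ^ 6" where
  "alg_h4 = lie_of_differentials [0, 0, 0, 0, wedge 1 3, wedge 1 4 - wedge 2 3]"
definition alg_h6 :: "real ^ 6 \<Rightarrow> real ^ 6 \<Rightarrow> real ^ 6" where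
  "alg_h6 = lie_of_differentials [0, 0, 0, wedge 1 2, wedge 1 3, 0]"
definition alg_h7 :: "real ^ 6 \<Rightarrow> real ^ 6 \<Rightarrow> real ^ 6" where
  "alg_h7 = lie_of_differentials [0, 0, 0, wedge 1 2, wedge 1 3, - wedge 2 3]"
definition alg_h8 :: "real ^ 6 \<Rightarrow> real ^ 6 \<Rightarrow> real ^ 6" where
  "alg_h8 = lie_of_differentials [0, 0, 0, 0, 0, - wedge 2 3]"
definition alg_h9 :: "real ^ 6 \<Rightarrow> real ^ 6 \<Rightarrow> real ^ 6" where
  "alg_h9 = lie_of_differentials [0, 0, 0, wedge 1 2, 0, wedge 1 4 - wedge 2 3]"
definition alg_h10 :: "real ^ 6 \<Rightarrow> real ^ 6 \<Rightarrow> real ^ 6" where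
  "alg_h10 = lie_of_differentials [0, 0, 0, wedge 1 2, wedge 1 3, wedge 1 4]"
definition alg_h11 :: "real ^ 6 \<Rightarrow> real ^ 6 \<Rightarrow> real ^ 6" where
  "alg_h11 = lie_of_differentials [0, 0, 0, wedge 1 2, wedge 1 3, wedge 1 4 - wedge 2 3]"
definition alg_h17 :: "real ^ 6 \<Rightarrow> real ^ 6 \<Rightarrow> real ^ 6" where
  "alg_h17 = lie_of_differentials [0, 0, 0, wedge 1 2, 0, wedge 1 4]"
definition alg_h19 :: "real ^ 6 \<Rightarrow> real ^ 6 \<Rightarrow> real ^ 6" where
  "alg_h19 = lie_of_differentials [0, 0, 0, wedge 1 2, wedge 1 3, wedge 2 5 + wedge 3 4]"

definition heisenberg :: "real ^ 3 \<Rightarrow> real ^ 3 \<Rightarrow> real ^ 3" where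
  "heisenberg = lie_of_differentials [0, 0, wedge 1 2]"

lemmas alg_defs =
  alg_h3_def alg_h4_def alg_h6_def alg_h7_def alg_h8_def alg_h9_def alg_h10_def alg_h11_def alg_h17_def alg_h19_def

lemma lie_algebra_models:
  "lie_algebra alg_h3"
  "lie_algebra alg_h4"
  "lie_algebra alg_h6"
  "lie_algebra alg_h7"
  "lie_algebra alg_h8"
  "lie_algebra alg_h9"
  "lie_algebra alg_h10"
  "lie_algebra alg_h11"
  "lie_algebra alg_h17"
  "lie_algebra alg_h19"
  unfolding lie_algebra_def bilinear_def alg_defs
  by (auto intro!: linearI simp: lie_of_differentials_def vec_eq_iff forall_6 vector_6 wedge_def algebra_simps)

end

theory Submission
  imports Defs
begin

text \<open>
  Nilpotency of \<open>h\<close> forces a flag in \<open>V\<close>, so in a suitable basis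
  \<open>\<rho> x v\<^sub>1 = \<alpha> x v\<^sub>2 + \<beta> x v\<^sub>3\<close>, \<open>\<rho> x v\<^sub>2 = \<gamma> x v\<^sub>3\<close> and
  \<open>\<rho> x v\<^sub>3 = 0\<close> for linear functionals \<open>\<alpha>, \<beta>, \<gamma>\<close>, and in the (reversed, signed) dual
  basis \<open>\<rho>\<^sup>*\<close> has the same shape with \<open>(\<gamma>, - \<beta>, \<alpha>)\<close>.  The representation property says
  that \<open>\<alpha>\<close> and \<open>\<gamma>\<close> vanish on brackets and \<open>\<beta> [x, y] = \<gamma> x \<alpha> y - \<gamma> y \<alpha> x\<close>.
  Either \<open>\<alpha>\<close> and \<open>\<gamma>\<close> are independent, which needs a Heisenberg \<open>g\<close> and gives \<open>h\<^sub>1\<^sub>9\<close>, or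
  they are proportional, and one basis of \<open>g\<close> brings \<open>h\<close> and its dual simultaneously into a
  normal form whose type depends only on which of its parameters vanish.  The models
  are told apart by the dimension of the centre, being two-step, and having an abelian hyperplane.
\<close>

section \<open>Isomorphism as an equivalence relation\<close>

lemma lie_isomorphic_sym:
  assumes "lie_isomorphic b c"
  shows "lie_isomorphic c b"
proof -
  obtain f where f: "linear f" "bij f" "\<And>x y. f (b x y) = c (f x) (f y)"
    using assms by (auto simp: lie_isomorphic_def)
  have "inv f (c x y) = b (inv f x) (inv f y)" for x y
    by (metis f(2,3) bij_inv_eq_iff)
  moreover have "linear (inv f)"
    using f(1,2) by (metis bij_betw_def bij_imp_bij_inv linear_injective_left_inverse
        inv_o_cancel left_right_inverse_eq surj_iff o_id comp_assoc id_comp)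
  ultimately show ?thesis
    unfolding lie_isomorphic_def using bij_imp_bij_inv[OF f(2)] by blast
qed

lemma lie_isomorphic_trans:
  assumes "lie_isomorphic b c" and "lie_isomorphic c d"
  shows "lie_isomorphic b d"
proof -
  obtain f where f: "linear f" "bij f" "\<And>x y. f (b x y) = c (f x) (f y)"
    using assms by (auto simp: lie_isomorphic_def)
  obtain g where g: "linear g" "bij g" "\<And>x y. g (c x y) = d (g x) (g y)"
    using assms by (auto simp: lie_isomorphic_def)
  show ?thesis
    unfolding lie_isomorphic_def
    using linear_compose[OF f(1) g(1)] bij_comp[OF f(2) g(2)] f(3) g(3)
    by (intro exI[of _ "g \<circ> f"]) auto
qed

lemma lie_bracket_antisym:
  assumes "lie_algebra b"
  shows "b x y = - b y x"
proof -
  have b: "bilinear b" and alt: "\<And>x. b x x = 0" using assms by (auto simp: lie_algebra_def)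
  have "b x y + b y x = 0"
    using alt[of "x + y"] unfolding bilinear_ladd[OF b] bilinear_radd[OF b]
    by (simp add: alt add.commute)
  then show ?thesis by (simp add: eq_neg_iff_add_eq_0)
qed

section \<open>Ordered bases of three-dimensional spaces\<close>

text \<open>A basis as an ordered triple: independence excludes repeated vectors, which the set
  \<open>{x, y, z}\<close> would merge.\<close>

definition is_basis3 :: "'a::real_vector \<Rightarrow> 'a \<Rightarrow> 'a \<Rightarrow> bool" where
  "is_basis3 x y z \<longleftrightarrow>
     (\<forall>u. \<exists>r s t. u = r *\<^sub>R x + s *\<^sub>R y + t *\<^sub>R z) \<and>
     (\<forall>r s t. r *\<^sub>R x + s *\<^sub>R y + t *\<^sub>R z = 0 \<longrightarrow> r = 0 \<and> s = 0 \<and> t = 0)"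

lemma is_basis3_spanE:
  assumes "is_basis3 x y z"
  obtains r s t where "u = r *\<^sub>R x + s *\<^sub>R y + t *\<^sub>R z"
  using assms unfolding is_basis3_def by blast

lemma is_basis3_indep:
  assumes "is_basis3 x y z" and "r *\<^sub>R x + s *\<^sub>R y + t *\<^sub>R z = 0"
  shows "r = 0" "s = 0" "t = 0"
  using assms unfolding is_basis3_def by blast+

lemma is_basis3_unique:
  assumes "is_basis3 x y z"
    and "r *\<^sub>R x + s *\<^sub>R y + t *\<^sub>R z = r' *\<^sub>R x + s' *\<^sub>R y + t' *\<^sub>R z"
  shows "r = r'" "s = s'" "t = t'"
proof -
  have "(r - r') *\<^sub>R x + (s - s') *\<^sub>R y + (t - t') *\<^sub>R z = 0"
    using assms(2) by (simp add: algebra_simps)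
  from is_basis3_indep[OF assms(1) this] show "r = r'" "s = s'" "t = t'" by auto
qed

lemma span3: "span {x, y, z} = {r *\<^sub>R x + s *\<^sub>R y + t *\<^sub>R z | r s t. True}"
  for x y z :: "'a::real_vector"
proof (intro set_eqI iffI)
  fix u assume "u \<in> span {x, y, z}"
  then obtain r s t where "u - r *\<^sub>R x - s *\<^sub>R y = t *\<^sub>R z"
    by (auto simp: span_insert span_singleton)
  then have "u = r *\<^sub>R x + s *\<^sub>R y + t *\<^sub>R z" by (simp add: algebra_simps)
  then show "u \<in> {r *\<^sub>R x + s *\<^sub>R y + t *\<^sub>R z | r s t. True}" by blast
qed (safe; intro span_add span_scale span_base; simp)

text \<open>Vectors chosen successively outside the span of the earlier ones are independent, and a
  fourth such vector would exceed the dimension. The conclusion reverses the order of choice, as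
  suits a flag built from the bottom.\<close>

lemma is_basis3_not_in_span:
  fixes x y z :: "'a::real_vector"
  assumes dim: "dim (UNIV :: 'a set) = 3"
    and "x \<noteq> 0" and "y \<notin> span {x}" and "z \<notin> span {y, x}"
  shows "is_basis3 z y x"
proof -
  obtain B where B: "independent B" "span B = (UNIV :: 'a set)" "card B = 3"
    by (metis basis_exists dim span_UNIV subset_UNIV top.extremum_uniqueI)
  have ind: "independent {z, y, x}"
    using assms by (simp add: independent_insert)
  have ne: "x \<noteq> y" "z \<noteq> y" "z \<noteq> x"
    using assms by (auto intro: span_base)
  have sp: "u \<in> span {z, y, x}" for u
  proof (rule ccontr)
    assume u: "u \<notin> span {z, y, x}"
    then have "independent {u, z, y, x}" using ind by (simp add: independent_insert)
    \<comment> \<open>\<open>card\<close> of an infinite set is 0, so \<open>dim = 3\<close> also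
      excludes infinite dimension.\<close>
    moreover have "finite B" using B(3) by (metis card.infinite zero_neq_numeral)
    ultimately have "card {u, z, y, x} \<le> card B"
      using B(2) independent_span_bound by blast
    moreover have "card {u, z, y, x} = 4"
      using u ne by (auto simp: card_insert_if intro: span_base)
    ultimately show False using B(3) by simp
  qed
  have "r = 0 \<and> s = 0 \<and> t = 0" if "r *\<^sub>R z + s *\<^sub>R y + t *\<^sub>R x = 0" for r s t
  proof -
    have r: "r = 0"
    proof (rule ccontr)
      assume "r \<noteq> 0"
      have "z = (1 / r) *\<^sub>R (r *\<^sub>R z + s *\<^sub>R y + t *\<^sub>R x) - (s / r) *\<^sub>R y - (t / r) *\<^sub>R x"
        using \<open>r \<noteq> 0\<close> by (simp add: algebra_simps)
      then have "z = - (s / r) *\<^sub>R y - (t / r) *\<^sub>R x"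
        unfolding that by simp
      then have "z \<in> span {y, x}"
        by (metis insertI1 insertI2 singletonI span_base span_diff span_scale)
      then show False using assms by simp
    qed
    have s: "s = 0"
    proof (rule ccontr)
      assume "s \<noteq> 0"
      have "y = (1 / s) *\<^sub>R (r *\<^sub>R z + s *\<^sub>R y + t *\<^sub>R x) - (t / s) *\<^sub>R x"
        using \<open>s \<noteq> 0\<close> r by (simp add: algebra_simps)
      then have "y = - (t / s) *\<^sub>R x"
        unfolding that by simp
      then have "y \<in> span {x}"
        by (metis singletonI span_base span_scale)
      then show False using assms by simp
    qed
    show ?thesis using r s that assms(2) by simp
  qed
  moreover have "\<exists>r s t. u = r *\<^sub>R z + s *\<^sub>R y + t *\<^sub>R x" for u
    using sp[of u] by (simp add: span3)
  ultimately show ?thesis unfolding is_basis3_def by blast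
qed

lemma is_basis3I:
  fixes x y z :: "'a::real_vector"
  assumes dim: "dim (UNIV :: 'a set) = 3"
    and ind: "\<And>r s t. r *\<^sub>R x + s *\<^sub>R y + t *\<^sub>R z = 0 \<Longrightarrow> r = 0 \<and> s = 0 \<and> t = 0"
  shows "is_basis3 x y z"
proof (rule is_basis3_not_in_span[OF dim])
  show "z \<noteq> 0" using ind[of 0 0 1] by auto
  show "y \<notin> span {z}"
  proof
    assume "y \<in> span {z}"
    then obtain t where "y = t *\<^sub>R z" by (auto simp: span_singleton)
    then show False using ind[of 0 1 "- t"] by simp
  qed
  show "x \<notin> span {y, z}"
  proof
    assume "x \<in> span {y, z}"
    then obtain s t where "x - s *\<^sub>R y = t *\<^sub>R z" by (auto simp: span_insert span_singleton)
    then have "x = s *\<^sub>R y + t *\<^sub>R z" by (simp add: algebra_simps)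
    then show False using ind[of 1 "- s" "- t"] by (simp add: algebra_simps)
  qed
qed

lemma is_basis3_coordinates:
  assumes "is_basis3 x y z"
  obtains k1 k2 k3 where "linear k1" "linear k2" "linear k3"
    "\<And>u. u = k1 u *\<^sub>R x + k2 u *\<^sub>R y + k3 u *\<^sub>R z"
    "\<And>r s t. k1 (r *\<^sub>R x + s *\<^sub>R y + t *\<^sub>R z) = r"
    "\<And>r s t. k2 (r *\<^sub>R x + s *\<^sub>R y + t *\<^sub>R z) = s"
    "\<And>r s t. k3 (r *\<^sub>R x + s *\<^sub>R y + t *\<^sub>R z) = t"
proof -
  obtain k1 k2 k3 where k: "\<And>u. u = k1 u *\<^sub>R x + k2 u *\<^sub>R y + k3 u *\<^sub>R z"
    using assms unfolding is_basis3_def by metis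
  have e: "k1 (r *\<^sub>R x + s *\<^sub>R y + t *\<^sub>R z) = r" "k2 (r *\<^sub>R x + s *\<^sub>R y + t *\<^sub>R z) = s"
    "k3 (r *\<^sub>R x + s *\<^sub>R y + t *\<^sub>R z) = t" for r s t
    using is_basis3_unique[OF assms k[of "r *\<^sub>R x + s *\<^sub>R y + t *\<^sub>R z"]] by simp_all
  have add: "u + v = (k1 u + k1 v) *\<^sub>R x + (k2 u + k2 v) *\<^sub>R y + (k3 u + k3 v) *\<^sub>R z" for u v
    by (subst (1) k[of u], subst (1) k[of v]) (simp add: algebra_simps)
  have scale: "c *\<^sub>R u = (c * k1 u) *\<^sub>R x + (c * k2 u) *\<^sub>R y + (c * k3 u) *\<^sub>R z" for c u
    by (subst (1) k[of u]) (simp add: algebra_simps)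
  have "linear k1" "linear k2" "linear k3"
    by (rule linearI; (subst add | subst scale); simp add: e)+
  then show thesis using that k e by blast
qed

subsection \<open>Flags from nilpotency\<close>

text \<open>Stands in for Engel's theorem: at the first \<open>m\<close> with
  \<open>W m \<subseteq> S\<close>, any vector of \<open>W (m - 1)\<close> outside \<open>S\<close>
  is moved by every \<open>\<rho> x\<close> into \<open>W m\<close>, hence into
  \<open>S\<close>.\<close>

lemma descending_chain_step:
  assumes "W 0 = UNIV" and "\<And>n x v. v \<in> W n \<Longrightarrow> \<rho> x v \<in> W (Suc n)" and "W N = {0}"
    and "0 \<in> S" and "S \<noteq> UNIV"
  shows "\<exists>v. v \<notin> S \<and> (\<forall>x. \<rho> x v \<in> S)"
proof -
  define m where "m = (LEAST n. W n \<subseteq> S)"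
  have m: "W m \<subseteq> S" unfolding m_def by (rule LeastI[of _ N]) (use assms in auto)
  then have "m \<noteq> 0" using assms by auto
  then obtain k where k: "m = Suc k" using not0_implies_Suc by blast
  then have "\<not> W k \<subseteq> S" using not_less_Least[of k "\<lambda>n. W n \<subseteq> S"] by (simp add: m_def)
  then obtain v where "v \<in> W k" "v \<notin> S" by blast
  then show ?thesis using assms(2)[of v k] m k by blast
qed

lemma dim3_not_span2:
  fixes x y :: "'a::real_vector"
  assumes "dim (UNIV :: 'a set) = 3"
  shows "span {x, y} \<noteq> UNIV"
proof
  assume "span {x, y} = UNIV"
  then have "dim (UNIV :: 'a set) \<le> card {x, y}"
    by (intro dim_le_card) auto
  then show False using assms by (auto simp: card_insert_if split: if_splits)
qed

text \<open>The chain step is applied to \<open>{0}\<close>, \<open>span {v3}\<close> and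
  \<open>span {v2, v3}\<close> in turn. The lemma serves twice: for \<open>\<rho>\<close> on V, and
  for the bracket acting on the three-dimensional algebra itself.\<close>

lemma nilpotent_flag:
  fixes \<rho> :: "'g \<Rightarrow> 'v::real_vector \<Rightarrow> 'v"
  assumes dim: "dim (UNIV :: 'v set) = 3"
    and W: "W 0 = UNIV" "\<And>n x v. v \<in> W n \<Longrightarrow> \<rho> x v \<in> W (Suc n)" "W N = {0}"
  obtains v1 v2 v3 where "is_basis3 v1 v2 v3"
    "\<And>x. \<rho> x v1 \<in> span {v2, v3}" "\<And>x. \<rho> x v2 \<in> span {v3}" "\<And>x. \<rho> x v3 = 0"
proof -
  note step = descending_chain_step[of W \<rho>, OF W]
  note ns = dim3_not_span2[OF dim]
  have "{0 :: 'v} \<noteq> UNIV" "span {v} \<noteq> UNIV" for v :: 'v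
    using ns[of 0 0] ns[of v v] by auto
  note ns = this ns
  obtain v3 where v3: "v3 \<noteq> 0" "\<And>x. \<rho> x v3 = 0"
    using step[of "{0}"] ns by auto
  obtain v2 where v2: "v2 \<notin> span {v3}" "\<And>x. \<rho> x v2 \<in> span {v3}"
    using step[of "span {v3}"] ns span_zero by blast
  obtain v1 where v1: "v1 \<notin> span {v2, v3}" "\<And>x. \<rho> x v1 \<in> span {v2, v3}"
    using step[of "span {v2, v3}"] ns span_zero by blast
  show thesis
    using that[of v1 v2 v3] is_basis3_not_in_span[OF dim v3(1) v2(1) v1(1)] v1 v2 v3 by blast
qed

section \<open>Triangular representations and their duals\<close>

text \<open>In the strictly triangular matrix of \<open>\<rho> x\<close>, \<open>\<beta>\<close> is
  the corner entry. No bracket is mentioned, so the predicate passes to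
  \<open>dual_rep \<rho>\<close> on its own.\<close>

definition triangular_rep ::
  "('g \<Rightarrow> 'v::real_vector \<Rightarrow> 'v) \<Rightarrow> 'v \<Rightarrow> 'v \<Rightarrow> 'v \<Rightarrow>
    ('g::real_vector \<Rightarrow> real) \<Rightarrow> ('g \<Rightarrow> real) \<Rightarrow> ('g \<Rightarrow> real) \<Rightarrow> bool" where
  "triangular_rep \<rho> v1 v2 v3 \<alpha> \<beta> \<gamma> \<longleftrightarrow>
     is_basis3 v1 v2 v3 \<and> bilinear \<rho> \<and> linear \<alpha> \<and> linear \<beta> \<and> linear \<gamma> \<and>
     (\<forall>x. \<rho> x v1 = \<alpha> x *\<^sub>R v2 + \<beta> x *\<^sub>R v3 \<and> \<rho> x v2 = \<gamma> x *\<^sub>R v3 \<and> \<rho> x v3 = 0)"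

lemma triangular_rep_exists:
  fixes \<rho> :: "'g::real_vector \<Rightarrow> 'v::real_vector \<Rightarrow> 'v"
  assumes dim: "dim (UNIV :: 'v set) = 3" and \<rho>: "bilinear \<rho>"
    and W: "W 0 = UNIV" "\<And>n x v. v \<in> W n \<Longrightarrow> \<rho> x v \<in> W (Suc n)" "W N = {0}"
  obtains v1 v2 v3 \<alpha> \<beta> \<gamma> where "triangular_rep \<rho> v1 v2 v3 \<alpha> \<beta> \<gamma>"
proof -
  obtain v1 v2 v3 where v: "is_basis3 v1 v2 v3"
    "\<And>x. \<rho> x v1 \<in> span {v2, v3}" "\<And>x. \<rho> x v2 \<in> span {v3}" "\<And>x. \<rho> x v3 = 0"
    using nilpotent_flag[OF dim, of W \<rho>, OF W] by blast
  obtain k1 k2 k3 where k: "linear k1" "linear k2" "linear k3"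
    "\<And>u. u = k1 u *\<^sub>R v1 + k2 u *\<^sub>R v2 + k3 u *\<^sub>R v3"
    "\<And>r s t. k1 (r *\<^sub>R v1 + s *\<^sub>R v2 + t *\<^sub>R v3) = r"
    "\<And>r s t. k2 (r *\<^sub>R v1 + s *\<^sub>R v2 + t *\<^sub>R v3) = s"
    "\<And>r s t. k3 (r *\<^sub>R v1 + s *\<^sub>R v2 + t *\<^sub>R v3) = t"
    using is_basis3_coordinates[OF v(1)] by blast
  have lin: "linear (\<lambda>x. f (\<rho> x v))" if "linear f" for f :: "'v \<Rightarrow> real" and v
    using linear_compose[OF _ that, of "\<lambda>x. \<rho> x v"] \<rho> by (simp add: bilinear_def o_def)
  have "\<rho> x v1 = k2 (\<rho> x v1) *\<^sub>R v2 + k3 (\<rho> x v1) *\<^sub>R v3" for x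
  proof -
    obtain s t where "\<rho> x v1 - s *\<^sub>R v2 = t *\<^sub>R v3"
      using v(2)[of x] by (auto simp: span_insert span_singleton)
    then have "\<rho> x v1 = 0 *\<^sub>R v1 + s *\<^sub>R v2 + t *\<^sub>R v3" by (simp add: algebra_simps)
    then show ?thesis using k(6,7)[of 0 s t] by simp
  qed
  moreover have "\<rho> x v2 = k3 (\<rho> x v2) *\<^sub>R v3" for x
  proof -
    obtain t where "\<rho> x v2 = t *\<^sub>R v3"
      using v(3)[of x] by (auto simp: span_singleton)
    then show ?thesis using k(7)[of 0 0 t] by simp
  qed
  ultimately have "triangular_rep \<rho> v1 v2 v3 (\<lambda>x. k2 (\<rho> x v1)) (\<lambda>x. k3 (\<rho> x v1)) (\<lambda>x. k3 (\<rho> x v2))"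
    unfolding triangular_rep_def using v \<rho> k(1-3) lin by blast
  then show thesis by (rule that)
qed

lemma triangular_rep_dual:
  assumes "triangular_rep \<rho> v1 v2 v3 \<alpha> \<beta> \<gamma>"
  obtains w1 w2 w3 where "triangular_rep (dual_rep \<rho>) w1 w2 w3 \<gamma> (\<lambda>x. - \<beta> x) \<alpha>"
proof -
  have v: "is_basis3 v1 v2 v3" and \<rho>: "bilinear \<rho>" and lin: "linear \<alpha>" "linear \<beta>" "linear \<gamma>"
    and r: "\<And>x. \<rho> x v1 = \<alpha> x *\<^sub>R v2 + \<beta> x *\<^sub>R v3" "\<And>x. \<rho> x v2 = \<gamma> x *\<^sub>R v3" "\<And>x. \<rho> x v3 = 0"
    using assms by (auto simp: triangular_rep_def)
  obtain k1 k2 k3 where k: "linear k1" "linear k2" "linear k3"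
    "\<And>u. u = k1 u *\<^sub>R v1 + k2 u *\<^sub>R v2 + k3 u *\<^sub>R v3"
    "\<And>r s t. k1 (r *\<^sub>R v1 + s *\<^sub>R v2 + t *\<^sub>R v3) = r"
    "\<And>r s t. k2 (r *\<^sub>R v1 + s *\<^sub>R v2 + t *\<^sub>R v3) = s"
    "\<And>r s t. k3 (r *\<^sub>R v1 + s *\<^sub>R v2 + t *\<^sub>R v3) = t"
    using is_basis3_coordinates[OF v] by blast
  have kv: "k1 v1 = 1" "k1 v2 = 0" "k1 v3 = 0" "k2 v1 = 0" "k2 v2 = 1" "k2 v3 = 0"
    "k3 v1 = 0" "k3 v2 = 0" "k3 v3 = 1"
    using k(5)[of 1 0 0] k(5)[of 0 1 0] k(5)[of 0 0 1] k(6)[of 1 0 0] k(6)[of 0 1 0] k(6)[of 0 0 1]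
      k(7)[of 1 0 0] k(7)[of 0 1 0] k(7)[of 0 0 1] by simp_all
  \<comment> \<open>Reversing the dual basis makes the transposed matrices triangular again; the
    sign of \<open>w2\<close> cancels that of the dual representation in two entries, so that only
    \<open>\<beta>\<close> is negated.\<close>
  define w1 where "w1 = Dual k3"
  define w2 where "w2 = - Dual k2"
  define w3 where "w3 = Dual k1"
  have w: "dual_apply w1 u = k3 u" "dual_apply w2 u = - k2 u" "dual_apply w3 u = k1 u" for u
    using k(1-3) by (simp_all add: w1_def w2_def w3_def dual_apply_simps Dual_inverse)
  have lr: "linear (\<rho> x)" for x using \<rho> by (simp add: bilinear_def)
  have ru: "\<rho> x u = 0 *\<^sub>R v1 + (\<alpha> x * k1 u) *\<^sub>R v2 + (\<beta> x * k1 u + \<gamma> x * k2 u) *\<^sub>R v3" for x u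
    by (subst k(4)[of u])
      (simp add: linear_add[OF lr] linear_cmul[OF lr] r algebra_simps)
  have kr: "k1 (\<rho> x u) = 0" "k2 (\<rho> x u) = \<alpha> x * k1 u" "k3 (\<rho> x u) = \<beta> x * k1 u + \<gamma> x * k2 u" for x u
    unfolding ru[of x u] k(5-7) by simp_all
  have au: "dual_apply a u = k1 u * dual_apply a v1 + k2 u * dual_apply a v2 + k3 u * dual_apply a v3" for a u
    by (subst k(4)[of u])
      (simp add: linear_add[OF linear_dual_apply] linear_cmul[OF linear_dual_apply])
  have "is_basis3 w1 w2 w3"
    unfolding is_basis3_def
  proof (intro conjI allI impI)
    fix a
    have "a = dual_apply a v3 *\<^sub>R w1 + (- dual_apply a v2) *\<^sub>R w2 + dual_apply a v1 *\<^sub>R w3"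
      by (rule dual_eqI, subst au) (simp add: dual_apply_simps w)
    then show "\<exists>r s t. a = r *\<^sub>R w1 + s *\<^sub>R w2 + t *\<^sub>R w3" by blast
  next
    fix r s t assume "r *\<^sub>R w1 + s *\<^sub>R w2 + t *\<^sub>R w3 = 0"
    then have "dual_apply (r *\<^sub>R w1 + s *\<^sub>R w2 + t *\<^sub>R w3) u = dual_apply 0 u" for u by simp
    then have "r * k3 u - s * k2 u + t * k1 u = 0" for u by (simp add: dual_apply_simps w)
    from this[of v1] this[of v2] this[of v3] show "r = 0" "s = 0" "t = 0" by (auto simp: kv)
  qed
  moreover have "bilinear (dual_rep \<rho>)"
    unfolding bilinear_def using \<rho>
    by (auto intro!: linearI dual_eqI simp: dual_rep_apply[of \<rho>, OF lr] dual_apply_simps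
      bilinear_ladd bilinear_lmul linear_add[OF linear_dual_apply] linear_cmul[OF linear_dual_apply])
  moreover have "dual_rep \<rho> x w1 = \<gamma> x *\<^sub>R w2 + - \<beta> x *\<^sub>R w3" "dual_rep \<rho> x w2 = \<alpha> x *\<^sub>R w3"
    "dual_rep \<rho> x w3 = 0" for x
    by (rule dual_eqI; simp add: dual_rep_apply[of \<rho>, OF lr] dual_apply_simps w kr algebra_simps)+
  moreover have "linear (\<lambda>x. - \<beta> x)"
    using linear_compose_neg[OF lin(2)] by simp
  ultimately have "triangular_rep (dual_rep \<rho>) w1 w2 w3 \<gamma> (\<lambda>x. - \<beta> x) \<alpha>"
    unfolding triangular_rep_def using lin by auto
  then show thesis by (rule that)
qed

text \<open>In the coordinates of \<open>x\<^sub>1, x\<^sub>2, x\<^sub>3, v\<^sub>1, v\<^sub>2, v\<^sub>3\<close>, where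
  \<open>[x\<^sub>1, x\<^sub>2] = \<delta> x\<^sub>3\<close>; the vectors \<open>a, b, c\<close> hold the values of
  \<open>\<alpha>, \<beta>, \<gamma>\<close> on \<open>x\<^sub>1, x\<^sub>2, x\<^sub>3\<close>.\<close>

definition std_bracket :: "real \<Rightarrow> real ^ 3 \<Rightarrow> real ^ 3 \<Rightarrow> real ^ 3 \<Rightarrow> real ^ 6 \<Rightarrow> real ^ 6 \<Rightarrow> real ^ 6" where
  "std_bracket \<delta> a b c x y = vector [0, 0, \<delta> * wedge 1 2 x y, 0,
     a $ 1 * wedge 1 4 x y + a $ 2 * wedge 2 4 x y + a $ 3 * wedge 3 4 x y,
     b $ 1 * wedge 1 4 x y + b $ 2 * wedge 2 4 x y + b $ 3 * wedge 3 4 x y +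
     c $ 1 * wedge 1 5 x y + c $ 2 * wedge 2 5 x y + c $ 3 * wedge 3 5 x y]"

text \<open>Both brackets are bilinear and agree on the chosen bases. The parameter
  \<open>\<delta>\<close> covers an abelian \<open>b\<close> (0) and a Heisenberg one (1) at
  once.\<close>

lemma semidirect_isomorphic_std:
  fixes b :: "'g::real_vector \<Rightarrow> 'g \<Rightarrow> 'g" and \<rho> :: "'g \<Rightarrow> 'v::real_vector \<Rightarrow> 'v"
  assumes b: "lie_algebra b" and e: "is_basis3 e1 e2 e3"
    and br: "b e1 e2 = \<delta> *\<^sub>R e3" "b e1 e3 = 0" "b e2 e3 = 0"
    and tr: "triangular_rep \<rho> v1 v2 v3 \<alpha> \<beta> \<gamma>"
  shows "lie_isomorphic (semidirect b \<rho>)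
    (std_bracket \<delta> (vector [\<alpha> e1, \<alpha> e2, \<alpha> e3]) (vector [\<beta> e1, \<beta> e2, \<beta> e3]) (vector [\<gamma> e1, \<gamma> e2, \<gamma> e3]))"
    (is "lie_isomorphic _ ?k")
proof (rule lie_isomorphic_sym)
  have v: "is_basis3 v1 v2 v3" and \<rho>: "bilinear \<rho>" and lin: "linear \<alpha>" "linear \<beta>" "linear \<gamma>"
    and r: "\<And>x. \<rho> x v1 = \<alpha> x *\<^sub>R v2 + \<beta> x *\<^sub>R v3" "\<And>x. \<rho> x v2 = \<gamma> x *\<^sub>R v3" "\<And>x. \<rho> x v3 = 0"
    using tr by (auto simp: triangular_rep_def)
  have bb: "bilinear b" and alt: "\<And>x. b x x = 0" using b by (auto simp: lie_algebra_def)
  note anti = lie_bracket_antisym[OF b]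
  have br': "b e2 e1 = - \<delta> *\<^sub>R e3" "b e3 e1 = 0" "b e3 e2 = 0"
    using br anti[of e2 e1] anti[of e3 e1] anti[of e3 e2] by simp_all
  define f :: "real ^ 6 \<Rightarrow> _" where "f x = (x $ 1 *\<^sub>R e1 + x $ 2 *\<^sub>R e2 + x $ 3 *\<^sub>R e3,
    x $ 4 *\<^sub>R v1 + x $ 5 *\<^sub>R v2 + x $ 6 *\<^sub>R v3)" for x
  have "linear f" by (auto intro!: linearI simp: f_def algebra_simps)
  moreover have "bij f"
    unfolding bij_def
  proof
    show "inj f"
    proof (rule injI)
      fix x y assume "f x = f y"
      then have "x $ 1 *\<^sub>R e1 + x $ 2 *\<^sub>R e2 + x $ 3 *\<^sub>R e3 = y $ 1 *\<^sub>R e1 + y $ 2 *\<^sub>R e2 + y $ 3 *\<^sub>R e3"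
        "x $ 4 *\<^sub>R v1 + x $ 5 *\<^sub>R v2 + x $ 6 *\<^sub>R v3 = y $ 4 *\<^sub>R v1 + y $ 5 *\<^sub>R v2 + y $ 6 *\<^sub>R v3"
        by (simp_all add: f_def)
      from is_basis3_unique[OF e this(1)] is_basis3_unique[OF v this(2)]
      show "x = y" by (simp add: vec_eq_iff forall_6)
    qed
    show "surj f"
    proof (unfold surj_def, rule allI)
      fix z :: "'g \<times> 'v"
      obtain x u where z: "z = (x, u)" by (cases z)
      obtain r s t where x: "x = r *\<^sub>R e1 + s *\<^sub>R e2 + t *\<^sub>R e3" by (rule is_basis3_spanE[OF e])
      obtain r' s' t' where u: "u = r' *\<^sub>R v1 + s' *\<^sub>R v2 + t' *\<^sub>R v3" by (rule is_basis3_spanE[OF v])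
      have "f (vector [r, s, t, r', s', t']) = z" by (simp add: f_def z x u vector_6)
      then show "\<exists>y. z = f y" by metis
    qed
  qed
  moreover have "f (?k x y) = semidirect b \<rho> (f x) (f y)" for x y
    by (simp add: f_def semidirect_def std_bracket_def vector_6 wedge_def br br' alt r
        bilinear_ladd[OF bb] bilinear_radd[OF bb] bilinear_lmul[OF bb] bilinear_rmul[OF bb]
        bilinear_ladd[OF \<rho>] bilinear_radd[OF \<rho>] bilinear_lmul[OF \<rho>] bilinear_rmul[OF \<rho>]
        linear_add[OF lin(1)] linear_add[OF lin(2)] linear_add[OF lin(3)]
        linear_cmul[OF lin(1)] linear_cmul[OF lin(2)] linear_cmul[OF lin(3)] algebra_simps)
  ultimately show "lie_isomorphic ?k (semidirect b \<rho>)"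
    unfolding lie_isomorphic_def by blast
qed

subsection \<open>Normal forms\<close>

text \<open>An injective linear endomorphism of \<open>real ^ 6\<close> is bijective, so a trivial
  kernel is enough. The map runs from the model \<open>b\<close> to the algebra \<open>c\<close>
  that is to be identified.\<close>

lemma lie_isomorphic_vec6I:
  fixes b c :: "real ^ 6 \<Rightarrow> real ^ 6 \<Rightarrow> real ^ 6"
  assumes "linear f" and "\<And>x. f x = 0 \<Longrightarrow> x = 0" and "\<And>x y. f (b x y) = c (f x) (f y)"
  shows "lie_isomorphic c b"
proof -
  have "inj f" using assms(1,2) by (simp add: linear_injective_0)
  then have "bij f" using assms(1) by (simp add: bij_def linear_injective_imp_surjective)
  then have "lie_isomorphic b c" using assms(1,3) by (auto simp: lie_isomorphic_def)
  then show ?thesis by (rule lie_isomorphic_sym)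
qed

text \<open>\<open>p\<close> and \<open>q\<close> are the values of \<open>\<alpha>\<close> and
  \<open>\<gamma>\<close> at the first basis vector of the acting algebra, \<open>r\<close> and
  \<open>s\<close> those of \<open>\<beta>\<close> at the first two; all other values are 0. Passing
  to the dual swaps \<open>p\<close> with \<open>q\<close> and negates \<open>r\<close> and
  \<open>s\<close>.\<close>

definition nf :: "real \<Rightarrow> real \<Rightarrow> real \<Rightarrow> real \<Rightarrow> real \<Rightarrow> real ^ 6 \<Rightarrow> real ^ 6 \<Rightarrow> real ^ 6" where
  "nf \<delta> p q r s = std_bracket \<delta> (vector [p, 0, 0]) (vector [r, s, 0]) (vector [q, 0, 0])"

lemmas vec6_simps = vec_eq_iff forall_6 vector_6

lemmas nf_simps = nf_def std_bracket_def alg_defs lie_of_differentials_def wedge_def vec6_simps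

text \<open>In this lemma and the next ones, generators of the model are sent to chosen vectors
  (here e1, e2, e3 to x1, v1, x2) and the brackets force the remaining images. A bracket is minus
  the listed differential, whence the signs.\<close>

lemma nf1_h10:
  "p \<noteq> 0 \<Longrightarrow> q \<noteq> 0 \<Longrightarrow> lie_isomorphic (nf 1 p q r 0) alg_h10"
  by (rule lie_isomorphic_vec6I[where f = "\<lambda>x. vector [x$1, x$3, - x$5, x$2, - p * x$4, - r * x$4 + p * q * x$6]"],
      (rule linearI; simp add: vec6_simps algebra_simps),
      (auto simp: vec6_simps)[1],
      (simp add: nf_simps; simp add: field_simps)?)

text \<open>The factor \<open>- (p * q / s)\<close> in the image of e3 makes [e2, e3] the negative
  of [e1, e4], so neither the size nor the sign of \<open>s\<close> affects the type.\<close>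

lemma nf1_h11:
  "p \<noteq> 0 \<Longrightarrow> q \<noteq> 0 \<Longrightarrow> s \<noteq> 0 \<Longrightarrow> lie_isomorphic (nf 1 p q r s) alg_h11"
  by (rule lie_isomorphic_vec6I[where f = "\<lambda>x. vector [x$1, - (p * q / s) * x$3, (p * q / s) * x$5, x$2, - p * x$4, - r * x$4 + p * q * x$6]"],
      (rule linearI; simp add: vec6_simps algebra_simps),
      (auto simp: vec6_simps)[1],
      (simp add: nf_simps; simp add: field_simps)?)

lemma nf1_h6_left:
  "p \<noteq> 0 \<Longrightarrow> lie_isomorphic (nf 1 p 0 r 0) alg_h6"
  by (rule lie_isomorphic_vec6I[where f = "\<lambda>x. vector [x$1, x$2, - x$4, x$3, - p * x$5, - r * x$5 + x$6]"],
      (rule linearI; simp add: vec6_simps algebra_simps),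
      (auto simp: vec6_simps)[1],
      (simp add: nf_simps; simp add: field_simps)?)

text \<open>h7 is the free two-step nilpotent algebra on three generators, here x1, x2, v1; their
  three brackets are independent since \<open>p\<close> and \<open>s\<close> are nonzero.\<close>

lemma nf1_h7:
  "p \<noteq> 0 \<Longrightarrow> s \<noteq> 0 \<Longrightarrow> lie_isomorphic (nf 1 p 0 r s) alg_h7"
  by (rule lie_isomorphic_vec6I[where f = "\<lambda>x. vector [x$1, x$2, - x$4, x$3, - p * x$5, - r * x$5 + s * x$6]"],
      (rule linearI; simp add: vec6_simps algebra_simps),
      (auto simp: vec6_simps)[1],
      (simp add: nf_simps; simp add: field_simps)?)

lemma nf1_h6_right:
  "q \<noteq> 0 \<Longrightarrow> lie_isomorphic (nf 1 0 q r 0) alg_h6"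
  by (rule lie_isomorphic_vec6I[where f = "\<lambda>x. vector [x$1, x$2, - x$4, x$6, x$3 - (r / q) * x$6, - q * x$5]"],
      (rule linearI; simp add: vec6_simps algebra_simps),
      (auto simp: vec6_simps)[1],
      (simp add: nf_simps; simp add: field_simps)?)

text \<open>The image of e2 is a multiple of \<open>v1 - (r / q) v2\<close>, which commutes with x1;
  the factor \<open>q / s\<close> makes [e2, e3] the negative of [e1, e4]. The image of e3 in
  \<open>nf0_h3\<close> is found in the same way.\<close>

lemma nf1_h4:
  "q \<noteq> 0 \<Longrightarrow> s \<noteq> 0 \<Longrightarrow> lie_isomorphic (nf 1 0 q r s) alg_h4"
  by (rule lie_isomorphic_vec6I[where f = "\<lambda>x. vector [x$1, x$3, - x$5, (q / s) * x$2, x$4 - (r / s) * x$2, - q * x$6]"],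
      (rule linearI; simp add: vec6_simps algebra_simps),
      (auto simp: vec6_simps)[1],
      (simp add: nf_simps; simp add: field_simps)?)

lemma nf1_h8:
  "lie_isomorphic (nf 1 0 0 0 0) alg_h8"
  by (rule lie_isomorphic_vec6I[where f = "\<lambda>x. vector [x$2, x$3, x$6, x$1, x$4, x$5]"],
      (rule linearI; simp add: vec6_simps algebra_simps),
      (auto simp: vec6_simps)[1],
      (simp add: nf_simps; simp add: field_simps)?)

lemma nf1_h6_center:
  "r \<noteq> 0 \<Longrightarrow> lie_isomorphic (nf 1 0 0 r 0) alg_h6"
  by (rule lie_isomorphic_vec6I[where f = "\<lambda>x. vector [x$1, x$2, - x$4, x$3, x$6, - r * x$5]"],
      (rule linearI; simp add: vec6_simps algebra_simps),
      (auto simp: vec6_simps)[1],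
      (simp add: nf_simps; simp add: field_simps)?)

lemma nf0_h17:
  "p \<noteq> 0 \<Longrightarrow> q \<noteq> 0 \<Longrightarrow> lie_isomorphic (nf 0 p q r 0) alg_h17"
  by (rule lie_isomorphic_vec6I[where f = "\<lambda>x. vector [x$1, x$3, x$5, x$2, - p * x$4, - r * x$4 + p * q * x$6]"],
      (rule linearI; simp add: vec6_simps algebra_simps),
      (auto simp: vec6_simps)[1],
      (simp add: nf_simps; simp add: field_simps)?)

lemma nf0_h9:
  "p \<noteq> 0 \<Longrightarrow> q \<noteq> 0 \<Longrightarrow> s \<noteq> 0 \<Longrightarrow> lie_isomorphic (nf 0 p q r s) alg_h9"
  by (rule lie_isomorphic_vec6I[where f = "\<lambda>x. vector [x$1, - (p * q / s) * x$3, x$5, x$2, - p * x$4, - r * x$4 + p * q * x$6]"],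
      (rule linearI; simp add: vec6_simps algebra_simps),
      (auto simp: vec6_simps)[1],
      (simp add: nf_simps; simp add: field_simps)?)

lemma nf0_h8_left:
  "p \<noteq> 0 \<Longrightarrow> lie_isomorphic (nf 0 p 0 r 0) alg_h8"
  by (rule lie_isomorphic_vec6I[where f = "\<lambda>x. vector [x$2, x$1, x$4, x$3, p * x$6, r * x$6 + x$5]"],
      (rule linearI; simp add: vec6_simps algebra_simps),
      (auto simp: vec6_simps)[1],
      (simp add: nf_simps; simp add: field_simps)?)

lemma nf0_h6:
  "p \<noteq> 0 \<Longrightarrow> s \<noteq> 0 \<Longrightarrow> lie_isomorphic (nf 0 p 0 r s) alg_h6"
  by (rule lie_isomorphic_vec6I[where f = "\<lambda>x. vector [x$2, x$3, x$6, x$1, p * x$4, r * x$4 + s * x$5]"],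
      (rule linearI; simp add: vec6_simps algebra_simps),
      (auto simp: vec6_simps)[1],
      (simp add: nf_simps; simp add: field_simps)?)

lemma nf0_h8_right:
  "q \<noteq> 0 \<Longrightarrow> lie_isomorphic (nf 0 0 q r 0) alg_h8"
  by (rule lie_isomorphic_vec6I[where f = "\<lambda>x. vector [x$2, x$4, x$5, x$1, x$3 - (r / q) * x$1, q * x$6]"],
      (rule linearI; simp add: vec6_simps algebra_simps),
      (auto simp: vec6_simps)[1],
      (simp add: nf_simps; simp add: field_simps)?)

lemma nf0_h3:
  "q \<noteq> 0 \<Longrightarrow> s \<noteq> 0 \<Longrightarrow> lie_isomorphic (nf 0 0 q r s) alg_h3"
  by (rule lie_isomorphic_vec6I[where f = "\<lambda>x. vector [x$1, x$2, x$5, - (q / s) * x$3, x$4 + (r / s) * x$3, - q * x$6]"],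
      (rule linearI; simp add: vec6_simps algebra_simps),
      (auto simp: vec6_simps)[1],
      (simp add: nf_simps; simp add: field_simps)?)

lemma nf0_h8_center:
  "r \<noteq> 0 \<Longrightarrow> lie_isomorphic (nf 0 0 0 r 0) alg_h8"
  by (rule lie_isomorphic_vec6I[where f = "\<lambda>x. vector [x$2, x$4, x$5, x$3, x$1, r * x$6]"],
      (rule linearI; simp add: vec6_simps algebra_simps),
      (auto simp: vec6_simps)[1],
      (simp add: nf_simps; simp add: field_simps)?)

text \<open>Since \<open>\<beta>\<close> is 1 at x3, replacing x1 by \<open>x1 - r x3\<close>
  removes \<open>r\<close>, while the image of e5 absorbs \<open>s\<close>. The dual is treated
  alike, with x1 and x2 exchanged.\<close>

lemma std_isomorphic_h19:
  "lie_isomorphic (std_bracket 1 (vector [0, 1, 0]) (vector [r, s, 1]) (vector [1, 0, 0])) alg_h19"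
  by (rule lie_isomorphic_vec6I[where f = "\<lambda>x. vector [x$2, x$1, x$4 - r * x$2, x$3, - x$5, - s * x$5 + x$6]"],
      (rule linearI; simp add: vec6_simps algebra_simps),
      (auto simp: vec6_simps)[1],
      (simp add: nf_simps; simp add: field_simps)?)

lemma std_isomorphic_h19_dual:
  "lie_isomorphic (std_bracket 1 (vector [1, 0, 0]) (vector [r, s, - 1]) (vector [0, 1, 0])) alg_h19"
  by (rule lie_isomorphic_vec6I[where f = "\<lambda>x. vector [x$1, x$2, - x$4 + s * x$2, x$3, - x$5, - r * x$5 + x$6]"],
      (rule linearI; simp add: vec6_simps algebra_simps),
      (auto simp: vec6_simps)[1],
      (simp add: nf_simps; simp add: field_simps)?)

section \<open>Models of an algebra and of its dual\<close>

definition abelian_pairs where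
  "abelian_pairs = {(alg_h3, alg_h6), (alg_h6, alg_h3), (alg_h8, alg_h8), (alg_h9, alg_h9), (alg_h17, alg_h17)}"

definition heisenberg_pairs where
  "heisenberg_pairs = {(alg_h4, alg_h7), (alg_h6, alg_h6), (alg_h7, alg_h4), (alg_h8, alg_h8),
     (alg_h10, alg_h10), (alg_h11, alg_h11), (alg_h19, alg_h19)}"

text \<open>The table of normal forms is applied to \<open>(p, q, r, s)\<close> and to the dual
  parameters \<open>(q, p, - r, - s)\<close>. The premise records the frame used when
  \<open>\<alpha>\<close> and \<open>\<gamma>\<close> vanish: its first vector carries all of a
  nonzero \<open>\<beta>\<close>.\<close>

lemma nf_abelian_pair:
  assumes "p = 0 \<Longrightarrow> q = 0 \<Longrightarrow> r \<noteq> 0 \<and> s = 0"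
  shows "\<exists>(k, k') \<in> abelian_pairs.
    lie_isomorphic (nf 0 p q r s) k \<and> lie_isomorphic (nf 0 q p (- r) (- s)) k'"
  using assms nf0_h17[of p q r] nf0_h17[of q p "- r"] nf0_h9[of p q s r] nf0_h9[of q p "- s" "- r"]
    nf0_h8_left[of p r] nf0_h8_left[of q "- r"] nf0_h6[of p s r] nf0_h6[of q "- s" "- r"]
    nf0_h8_right[of q r] nf0_h8_right[of p "- r"] nf0_h3[of q s r] nf0_h3[of p "- s" "- r"]
    nf0_h8_center[of r] nf0_h8_center[of "- r"]
  by (cases "p = 0"; cases "q = 0"; cases "s = 0") (simp_all add: abelian_pairs_def)

text \<open>As in the abelian case, except that \<open>p\<close>, \<open>q\<close>,
  \<open>r\<close>, \<open>s\<close> may all vanish: the zero representation of the Heisenberg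
  algebra still gives the non-abelian h8.\<close>

lemma nf_heisenberg_pair:
  assumes "p = 0 \<Longrightarrow> q = 0 \<Longrightarrow> s = 0"
  shows "\<exists>(k, k') \<in> heisenberg_pairs.
    lie_isomorphic (nf 1 p q r s) k \<and> lie_isomorphic (nf 1 q p (- r) (- s)) k'"
  using assms nf1_h10[of p q r] nf1_h10[of q p "- r"]
    nf1_h11[of p q s r] nf1_h11[of q p "- s" "- r"]
    nf1_h6_left[of p r] nf1_h6_left[of q "- r"] nf1_h7[of p s r] nf1_h7[of q "- s" "- r"]
    nf1_h6_right[of q r] nf1_h6_right[of p "- r"] nf1_h4[of q s r] nf1_h4[of p "- s" "- r"]
    nf1_h8 nf1_h6_center[of r] nf1_h6_center[of "- r"]
  by (cases "p = 0"; cases "q = 0"; cases "s = 0"; cases "r = 0") (simp_all add: heisenberg_pairs_def)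

section \<open>Constraints on the functionals and adapted frames\<close>

text \<open>A commutator of strictly triangular 3x3 matrices lives in the corner; the equations
  compare coefficients of \<open>\<rho> (b x y)\<close> at \<open>v1\<close> and
  \<open>v2\<close>.\<close>

lemma triangular_rep_bracket:
  assumes "lie_representation b \<rho>" and "triangular_rep \<rho> v1 v2 v3 \<alpha> \<beta> \<gamma>"
  shows "\<alpha> (b x y) = 0" "\<beta> (b x y) = \<gamma> x * \<alpha> y - \<gamma> y * \<alpha> x" "\<gamma> (b x y) = 0"
proof -
  have v: "is_basis3 v1 v2 v3" and \<rho>: "bilinear \<rho>"
    and r: "\<And>x. \<rho> x v1 = \<alpha> x *\<^sub>R v2 + \<beta> x *\<^sub>R v3" "\<And>x. \<rho> x v2 = \<gamma> x *\<^sub>R v3" "\<And>x. \<rho> x v3 = 0"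
    using assms(2) by (auto simp: triangular_rep_def)
  have rep: "\<rho> (b x y) v = \<rho> x (\<rho> y v) - \<rho> y (\<rho> x v)" for v
    using assms(1) by (auto simp: lie_representation_def)
  note lr = bilinear_radd[OF \<rho>] bilinear_rmul[OF \<rho>]
  have "0 *\<^sub>R v1 + \<alpha> (b x y) *\<^sub>R v2 + \<beta> (b x y) *\<^sub>R v3
      = 0 *\<^sub>R v1 + 0 *\<^sub>R v2 + (\<gamma> x * \<alpha> y - \<gamma> y * \<alpha> x) *\<^sub>R v3"
    using rep[of v1] by (simp add: r lr algebra_simps)
  from is_basis3_unique[OF v this]
  show "\<alpha> (b x y) = 0" "\<beta> (b x y) = \<gamma> x * \<alpha> y - \<gamma> y * \<alpha> x" by auto
  have "0 *\<^sub>R v1 + 0 *\<^sub>R v2 + \<gamma> (b x y) *\<^sub>R v3 = 0 *\<^sub>R v1 + 0 *\<^sub>R v2 + 0 *\<^sub>R v3"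
    using rep[of v2] by (simp add: r lr)
  from is_basis3_unique[OF v this] show "\<gamma> (b x y) = 0" by auto
qed

lemma triangular_rep_zero:
  assumes "triangular_rep \<rho> v1 v2 v3 (\<lambda>x. 0) (\<lambda>x. 0) (\<lambda>x. 0)"
  shows "\<rho> x u = 0"
proof -
  have v: "is_basis3 v1 v2 v3" and \<rho>: "bilinear \<rho>"
    and r: "\<rho> x v1 = 0" "\<rho> x v2 = 0" "\<rho> x v3 = 0"
    using assms by (auto simp: triangular_rep_def)
  obtain r s t where "u = r *\<^sub>R v1 + s *\<^sub>R v2 + t *\<^sub>R v3"
    by (rule is_basis3_spanE[OF v])
  then show ?thesis by (simp add: bilinear_radd[OF \<rho>] bilinear_rmul[OF \<rho>] r)
qed

text \<open>Take for \<open>f\<close> the first nonzero one of \<open>\<alpha>\<close> and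
  \<open>\<gamma>\<close>; by proportionality its kernel lies in the kernel of the other. If both
  vanish, \<open>\<beta>\<close> is taken, so that a frame adapted to \<open>f\<close> normalises
  \<open>\<beta>\<close> instead.\<close>

lemma proportional_functionals:
  fixes \<alpha> \<beta> \<gamma> :: "'g::real_vector \<Rightarrow> real"
  assumes "\<And>x y. \<gamma> x * \<alpha> y = \<gamma> y * \<alpha> x"
  obtains f where "f \<in> {\<alpha>, \<beta>, \<gamma>}" "\<And>x. f x = 0 \<Longrightarrow> \<alpha> x = 0 \<and> \<gamma> x = 0"
    "(\<And>x. \<alpha> x = 0) \<Longrightarrow> (\<And>x. \<gamma> x = 0) \<Longrightarrow> f = \<beta>"
proof (cases "\<exists>y. \<alpha> y \<noteq> 0")
  case True
  then obtain y where "\<alpha> y \<noteq> 0" by blast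
  then show ?thesis using that[of \<alpha>] assms[of _ y] by (metis insertI1 mult_eq_0_iff)
next
  case a: False
  show ?thesis
  proof (cases "\<exists>y. \<gamma> y \<noteq> 0")
    case True
    then show ?thesis using that[of \<gamma>] a by auto
  next
    case False
    then show ?thesis using that[of \<beta>] a by auto
  qed
qed

text \<open>The kernel of \<open>f\<close> is a plane, and \<open>g\<close> vanishes on at least a
  line of it. The third vector is taken on such a line, the second completes the plane, and the
  first is \<open>x0\<close>.\<close>

lemma kernel_frame:
  fixes f g :: "'g::real_vector \<Rightarrow> real"
  assumes dim: "dim (UNIV :: 'g set) = 3" and f: "linear f" and g: "linear g" and "f x0 \<noteq> 0"
  obtains e1 e2 e3 where "is_basis3 e1 e2 e3" "f e2 = 0" "f e3 = 0" "g e3 = 0"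
proof -
  have x0: "x0 \<noteq> 0" using assms(4) linear_0[OF f] by auto
  note lf = linear_add[OF f] linear_diff[OF f] linear_cmul[OF f] linear_0[OF f]
  note lg = linear_add[OF g] linear_diff[OF g] linear_cmul[OF g] linear_0[OF g]
  note ns = dim3_not_span2[OF dim]
  have "span {x0} \<noteq> UNIV" using ns[of x0 x0] by simp
  then obtain y where y: "y \<notin> span {x0}" by blast
  define u where "u = y - (f y / f x0) *\<^sub>R x0"
  have u: "f u = 0" using assms(4) by (simp add: u_def lf)
  have "u \<notin> span {x0}"
  proof
    assume "u \<in> span {x0}"
    then have "u + (f y / f x0) *\<^sub>R x0 \<in> span {x0}" by (simp add: span_add span_scale span_base)
    then show False using y by (simp add: u_def)
  qed
  note u = u this
  obtain z where z: "z \<notin> span {u, x0}" using ns[of u x0] by blast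
  define w where "w = z - (f z / f x0) *\<^sub>R x0"
  have w: "f w = 0" using assms(4) by (simp add: w_def lf)
  have "w \<notin> span {u, x0}"
  proof
    assume "w \<in> span {u, x0}"
    then have "w + (f z / f x0) *\<^sub>R x0 \<in> span {u, x0}" by (simp add: span_add span_scale span_base)
    then show False using z by (simp add: w_def)
  qed
  note w = w this
  have B: "is_basis3 w u x0" by (rule is_basis3_not_in_span[OF dim x0 u(2) w(2)])
  show thesis
  proof (cases "g w = 0")
    case True
    have "is_basis3 x0 u w"
    proof (rule is_basis3I[OF dim])
      fix p q r assume "p *\<^sub>R x0 + q *\<^sub>R u + r *\<^sub>R w = 0"
      then have "r *\<^sub>R w + q *\<^sub>R u + p *\<^sub>R x0 = 0" by (simp add: algebra_simps)
      from is_basis3_indep[OF B this] show "p = 0 \<and> q = 0 \<and> r = 0" by auto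
    qed
    then show thesis using that u w True by blast
  next
    case False
    \<comment> \<open>The combination of \<open>u\<close> and \<open>w\<close> that is killed by
      \<open>g\<close>.\<close>
    define t where "t = u - (g u / g w) *\<^sub>R w"
    have "is_basis3 x0 w t"
    proof (rule is_basis3I[OF dim])
      fix p q r assume "p *\<^sub>R x0 + q *\<^sub>R w + r *\<^sub>R t = 0"
      then have "(q - r * (g u / g w)) *\<^sub>R w + r *\<^sub>R u + p *\<^sub>R x0 = 0"
        by (simp add: t_def algebra_simps)
      from is_basis3_indep[OF B this] show "p = 0 \<and> q = 0 \<and> r = 0" by auto
    qed
    moreover have "f t = 0" "g t = 0" using u w False by (simp_all add: t_def lf lg)
    ultimately show thesis using that w by blast
  qed
qed

section \<open>The case of an abelian acting algebra\<close>

text \<open>A zero bracket makes \<open>\<alpha>\<close> and \<open>\<gamma>\<close> proportional,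
  so a suitable frame leaves only four parameters. It normalises the dual too, where the functionals
  are merely swapped and negated.\<close>

lemma semidirect_abelian:
  fixes b :: "'g::real_vector \<Rightarrow> 'g \<Rightarrow> 'g" and \<rho> :: "'g \<Rightarrow> 'v::real_vector \<Rightarrow> 'v"
  assumes b: "lie_algebra b" and dim: "dim (UNIV :: 'g set) = 3" and rep: "lie_representation b \<rho>"
    and tr: "triangular_rep \<rho> v1 v2 v3 \<alpha> \<beta> \<gamma>"
    and na: "\<not> lie_abelian (semidirect b \<rho>)" and ab: "lie_abelian b"
  shows "\<exists>(k, k') \<in> abelian_pairs.
    lie_isomorphic (semidirect b \<rho>) k \<and> lie_isomorphic (semidirect b (dual_rep \<rho>)) k'"
proof -
  have lin: "linear \<alpha>" "linear \<beta>" "linear \<gamma>" using tr by (auto simp: triangular_rep_def)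
  have b0: "b x y = 0" for x y using ab by (simp add: lie_abelian_def)
  have "\<gamma> x * \<alpha> y = \<gamma> y * \<alpha> x" for x y
    using triangular_rep_bracket(2)[OF rep tr, of x y] by (simp add: b0 linear_0[OF lin(2)])
  then obtain f where f: "f \<in> {\<alpha>, \<beta>, \<gamma>}" "\<And>x. f x = 0 \<Longrightarrow> \<alpha> x = 0 \<and> \<gamma> x = 0"
    "(\<And>x. \<alpha> x = 0) \<Longrightarrow> (\<And>x. \<gamma> x = 0) \<Longrightarrow> f = \<beta>"
    using proportional_functionals[of \<gamma> \<alpha> \<beta>] by blast
  \<comment> \<open>If \<open>f\<close> vanished, so would all three functionals and hence
    \<open>\<rho>\<close>, and the semi-direct product would be abelian.\<close>
  have "\<exists>x. f x \<noteq> 0"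
  proof (rule ccontr)
    assume "\<nexists>x. f x \<noteq> 0"
    then have "\<alpha> = (\<lambda>x. 0)" "\<beta> = (\<lambda>x. 0)" "\<gamma> = (\<lambda>x. 0)" using f(2,3) by auto
    then have "\<rho> x u = 0" for x u using tr triangular_rep_zero by blast
    then show False using na by (simp add: lie_abelian_def semidirect_def b0 zero_prod_def split_beta)
  qed
  then obtain x0 where x0: "f x0 \<noteq> 0" by blast
  have lf: "linear f" using f(1) lin by auto
  then obtain e1 e2 e3 where e: "is_basis3 e1 e2 e3" "f e2 = 0" "f e3 = 0" "\<beta> e3 = 0"
    using kernel_frame[OF dim lf lin(2), of x0] x0 by blast
  have z: "\<alpha> e2 = 0" "\<alpha> e3 = 0" "\<gamma> e2 = 0" "\<gamma> e3 = 0" using e f(2) by auto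
  have vanish: "g x = 0" if "linear g" "g e1 = 0" "g e2 = 0" "g e3 = 0" for g :: "'g \<Rightarrow> real" and x
  proof -
    obtain r s t where "x = r *\<^sub>R e1 + s *\<^sub>R e2 + t *\<^sub>R e3" by (rule is_basis3_spanE[OF e(1)])
    then show ?thesis using that by (simp add: linear_add linear_cmul)
  qed
  \<comment> \<open>Here \<open>f\<close> is \<open>\<beta>\<close>, which vanishes at
    \<open>e2\<close> and \<open>e3\<close> but not at \<open>x0\<close>.\<close>
  have "\<beta> e1 \<noteq> 0 \<and> \<beta> e2 = 0" if "\<alpha> e1 = 0" "\<gamma> e1 = 0"
  proof -
    have "f = \<beta>" using f(3) vanish[OF lin(1)] vanish[OF lin(3)] that z by blast
    then show ?thesis using vanish[OF lin(2), of x0] e x0 by auto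
  qed
  from nf_abelian_pair[of "\<alpha> e1" "\<gamma> e1", OF this] obtain k k' where k: "(k, k') \<in> abelian_pairs"
    "lie_isomorphic (nf 0 (\<alpha> e1) (\<gamma> e1) (\<beta> e1) (\<beta> e2)) k"
    "lie_isomorphic (nf 0 (\<gamma> e1) (\<alpha> e1) (- \<beta> e1) (- \<beta> e2)) k'" by auto
  have br: "b e1 e2 = 0 *\<^sub>R e3" "b e1 e3 = 0" "b e2 e3 = 0" by (simp_all add: b0)
  obtain w1 w2 w3 where w: "triangular_rep (dual_rep \<rho>) w1 w2 w3 \<gamma> (\<lambda>x. - \<beta> x) \<alpha>"
    by (rule triangular_rep_dual[OF tr])
  have "lie_isomorphic (semidirect b \<rho>) k"
    using semidirect_isomorphic_std[OF b e(1) br tr] k(2) lie_isomorphic_trans by (auto simp: nf_def z e)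
  moreover have "lie_isomorphic (semidirect b (dual_rep \<rho>)) k'"
    using semidirect_isomorphic_std[OF b e(1) br w] k(3) lie_isomorphic_trans by (auto simp: nf_def z e)
  ultimately show ?thesis using k(1) by blast
qed

section \<open>The case of the Heisenberg algebra\<close>

text \<open>The relation [x1, x2] = x3 with x3 central, stated on arbitrary combinations so that
  bilinearity is expanded only once.\<close>

definition heisenberg_basis :: "('g::real_vector \<Rightarrow> 'g \<Rightarrow> 'g) \<Rightarrow> 'g \<Rightarrow> 'g \<Rightarrow> 'g \<Rightarrow> bool" where
  "heisenberg_basis b x1 x2 x3 \<longleftrightarrow> is_basis3 x1 x2 x3 \<and>
     (\<forall>r s t r' s' t'. b (r *\<^sub>R x1 + s *\<^sub>R x2 + t *\<^sub>R x3) (r' *\<^sub>R x1 + s' *\<^sub>R x2 + t' *\<^sub>R x3)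
       = (r * s' - s * r') *\<^sub>R x3)"

text \<open>The flag of the bracket makes x3 central and leaves only [x1, x2] = c x3. Here c is
  nonzero because \<open>b\<close> is not abelian, and it is absorbed into x3.\<close>

lemma nilpotent_dim3_heisenberg_basis:
  fixes b :: "'g::real_vector \<Rightarrow> 'g \<Rightarrow> 'g"
  assumes b: "lie_algebra b" and dim: "dim (UNIV :: 'g set) = 3" and na: "\<not> lie_abelian b"
    and W: "W 0 = UNIV" "\<And>n x y. y \<in> W n \<Longrightarrow> b x y \<in> W (Suc n)" "W N = {0}"
  obtains x1 x2 x3 where "heisenberg_basis b x1 x2 x3"
proof -
  obtain x1 x2 x3 where x: "is_basis3 x1 x2 x3"
    "\<And>y. b y x1 \<in> span {x2, x3}" "\<And>y. b y x2 \<in> span {x3}" "\<And>y. b y x3 = 0"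
    using nilpotent_flag[OF dim, of W b, OF W] by blast
  have bb: "bilinear b" and alt: "\<And>x. b x x = 0" using b by (auto simp: lie_algebra_def)
  note anti = lie_bracket_antisym[OF b]
  note l = bilinear_ladd[OF bb] bilinear_radd[OF bb] bilinear_lmul[OF bb] bilinear_rmul[OF bb]
  obtain c where c: "b x1 x2 = c *\<^sub>R x3" using x(3)[of x1] by (auto simp: span_singleton)
  have br: "b x2 x1 = - c *\<^sub>R x3" "b x3 x1 = 0" "b x3 x2 = 0"
    using c x(4) anti[of x2 x1] anti[of x3 x1] anti[of x3 x2] by simp_all
  have table: "b (r *\<^sub>R x1 + s *\<^sub>R x2 + t *\<^sub>R x3) (r' *\<^sub>R x1 + s' *\<^sub>R x2 + t' *\<^sub>R x3)
      = ((r * s' - s * r') * c) *\<^sub>R x3" for r s t r' s' t'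
    by (simp add: l c br x alt algebra_simps)
  have "c \<noteq> 0"
  proof
    assume "c = 0"
    have "b x y = 0" for x y
    proof -
      obtain r s t where "x = r *\<^sub>R x1 + s *\<^sub>R x2 + t *\<^sub>R x3" by (rule is_basis3_spanE[OF x(1)])
      moreover obtain r' s' t' where "y = r' *\<^sub>R x1 + s' *\<^sub>R x2 + t' *\<^sub>R x3" by (rule is_basis3_spanE[OF x(1)])
      ultimately show ?thesis using table \<open>c = 0\<close> by simp
    qed
    then show False using na by (simp add: lie_abelian_def)
  qed
  have "is_basis3 x1 x2 (c *\<^sub>R x3)"
  proof (rule is_basis3I[OF dim])
    fix r s t assume "r *\<^sub>R x1 + s *\<^sub>R x2 + t *\<^sub>R c *\<^sub>R x3 = 0"
    with is_basis3_indep[OF x(1), of r s "t * c"] \<open>c \<noteq> 0\<close> show "r = 0 \<and> s = 0 \<and> t = 0" by simp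
  qed
  moreover have "b (r *\<^sub>R x1 + s *\<^sub>R x2 + t *\<^sub>R c *\<^sub>R x3) (r' *\<^sub>R x1 + s' *\<^sub>R x2 + t' *\<^sub>R c *\<^sub>R x3)
      = (r * s' - s * r') *\<^sub>R c *\<^sub>R x3" for r s t r' s' t'
    using table[of r s "t * c" r' s' "t' * c"] by simp
  ultimately have "heisenberg_basis b x1 x2 (c *\<^sub>R x3)" unfolding heisenberg_basis_def by blast
  then show thesis by (rule that)
qed

lemma heisenberg_isomorphic:
  fixes b :: "'g::real_vector \<Rightarrow> 'g \<Rightarrow> 'g"
  assumes "heisenberg_basis b x1 x2 x3"
  shows "lie_isomorphic b heisenberg"
proof (rule lie_isomorphic_sym)
  have x: "is_basis3 x1 x2 x3"
    and br: "\<And>r s t r' s' t'. b (r *\<^sub>R x1 + s *\<^sub>R x2 + t *\<^sub>R x3) (r' *\<^sub>R x1 + s' *\<^sub>R x2 + t' *\<^sub>R x3)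
      = (r * s' - s * r') *\<^sub>R x3"
    using assms by (auto simp: heisenberg_basis_def)
  \<comment> \<open>By the convention for differentials, \<open>heisenberg\<close> has [e1, e2] = -
    e3; hence the sign.\<close>
  define f :: "real ^ 3 \<Rightarrow> 'g" where "f u = u $ 1 *\<^sub>R x1 + u $ 2 *\<^sub>R x2 + (- u $ 3) *\<^sub>R x3" for u
  have "linear f" by (auto intro!: linearI simp: f_def algebra_simps)
  moreover have "bij f"
    unfolding bij_def
  proof
    show "inj f"
    proof (rule injI)
      fix u v assume "f u = f v"
      then show "u = v"
        using is_basis3_unique[OF x, of "u $ 1" "u $ 2" "- u $ 3" "v $ 1" "v $ 2" "- v $ 3"]
        by (simp add: f_def vec_eq_iff forall_3)
    qed
    show "surj f"
    proof (unfold surj_def, rule allI)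
      fix z
      obtain r s t where "z = r *\<^sub>R x1 + s *\<^sub>R x2 + t *\<^sub>R x3" by (rule is_basis3_spanE[OF x])
      then have "z = f (vector [r, s, - t])" by (simp add: f_def)
      then show "\<exists>y. z = f y" by blast
    qed
  qed
  moreover have "f (heisenberg u v) = b (f u) (f v)" for u v
    by (simp add: f_def br heisenberg_def lie_of_differentials_def wedge_def del: scaleR_minus_left)
  ultimately show "lie_isomorphic heisenberg b"
    unfolding lie_isomorphic_def by blast
qed

text \<open>\<open>\<beta> x3\<close> is the determinant of \<open>(\<gamma>, \<alpha>)\<close> on
  \<open>(x1, x2)\<close>. If it is 0, the functionals are proportional and a frame with third
  vector \<open>x3\<close> gives a normal form; otherwise they are coordinates on the plane of
  \<open>x1\<close> and \<open>x2\<close>, and h19 results.\<close>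

lemma semidirect_heisenberg:
  fixes b :: "'g::real_vector \<Rightarrow> 'g \<Rightarrow> 'g" and \<rho> :: "'g \<Rightarrow> 'v::real_vector \<Rightarrow> 'v"
  assumes b: "lie_algebra b" and dim: "dim (UNIV :: 'g set) = 3" and rep: "lie_representation b \<rho>"
    and tr: "triangular_rep \<rho> v1 v2 v3 \<alpha> \<beta> \<gamma>"
    and hb: "heisenberg_basis b x1 x2 x3"
  shows "\<exists>(k, k') \<in> heisenberg_pairs.
    lie_isomorphic (semidirect b \<rho>) k \<and> lie_isomorphic (semidirect b (dual_rep \<rho>)) k'"
proof -
  have x: "is_basis3 x1 x2 x3"
    and table: "\<And>r s t r' s' t'. b (r *\<^sub>R x1 + s *\<^sub>R x2 + t *\<^sub>R x3) (r' *\<^sub>R x1 + s' *\<^sub>R x2 + t' *\<^sub>R x3)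
      = (r * s' - s * r') *\<^sub>R x3"
    using hb by (auto simp: heisenberg_basis_def)
  have lin: "linear \<alpha>" "linear \<beta>" "linear \<gamma>" using tr by (auto simp: triangular_rep_def)
  note la = linear_add[OF lin(1)] linear_diff[OF lin(1)] linear_cmul[OF lin(1)] linear_0[OF lin(1)]
  note lb = linear_add[OF lin(2)] linear_diff[OF lin(2)] linear_cmul[OF lin(2)] linear_0[OF lin(2)]
  note lc = linear_add[OF lin(3)] linear_diff[OF lin(3)] linear_cmul[OF lin(3)] linear_0[OF lin(3)]
  have b12: "b (r *\<^sub>R x1 + s *\<^sub>R x2) (r' *\<^sub>R x1 + s' *\<^sub>R x2) = (r * s' - s * r') *\<^sub>R x3"
    and b13: "b (r *\<^sub>R x1 + s *\<^sub>R x2) (t *\<^sub>R x3) = 0" for r s t r' s'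
    using table[of r s 0 r' s' 0] table[of r s 0 0 0 t] by simp_all
  have x12: "b x1 x2 = x3" using b12[of 1 0 0 1] by simp
  note tb = triangular_rep_bracket[OF rep tr]
  have x3: "\<alpha> x3 = 0" "\<gamma> x3 = 0" "\<beta> x3 = \<gamma> x1 * \<alpha> x2 - \<gamma> x2 * \<alpha> x1"
    using tb[of x1 x2] by (simp_all add: x12)
  obtain w1 w2 w3 where w: "triangular_rep (dual_rep \<rho>) w1 w2 w3 \<gamma> (\<lambda>x. - \<beta> x) \<alpha>"
    by (rule triangular_rep_dual[OF tr])
  show ?thesis
  proof (cases "\<beta> x3 = 0")
    case True
    have "\<gamma> x * \<alpha> y = \<gamma> y * \<alpha> x" for x y
    proof -
      obtain r s t where "x = r *\<^sub>R x1 + s *\<^sub>R x2 + t *\<^sub>R x3" by (rule is_basis3_spanE[OF x])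
      moreover obtain r' s' t' where "y = r' *\<^sub>R x1 + s' *\<^sub>R x2 + t' *\<^sub>R x3" by (rule is_basis3_spanE[OF x])
      ultimately have "\<beta> (b x y) = 0" using table True by (simp add: lb)
      then show ?thesis using tb(2)[of x y] by simp
    qed
    then obtain f where f: "f \<in> {\<alpha>, \<beta>, \<gamma>}" "\<And>x. f x = 0 \<Longrightarrow> \<alpha> x = 0 \<and> \<gamma> x = 0"
      "(\<And>x. \<alpha> x = 0) \<Longrightarrow> (\<And>x. \<gamma> x = 0) \<Longrightarrow> f = \<beta>"
      using proportional_functionals[of \<gamma> \<alpha> \<beta>] by blast
    have lf: "linear f" using f(1) lin by auto
    have f3: "f x3 = 0" using f(1) x3 True by auto
    obtain e1 e2 where e: "is_basis3 e1 e2 x3" "b e1 e2 = 1 *\<^sub>R x3" "b e1 x3 = 0" "b e2 x3 = 0" "f e2 = 0"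
    \<comment> \<open>Then \<open>f\<close> is zero, and the given basis already has the required
      form.\<close>
    proof (cases "f x1 = 0 \<and> f x2 = 0")
      case True
      then show thesis using that[of x1 x2] x b12[of 1 0 0 1] b13[of 1 0 1] b13[of 0 1 1] by simp
    next
      case False
      define d where "d = f x1 * f x1 + f x2 * f x2"
      have d: "d \<noteq> 0" using False by (auto simp: d_def sum_squares_eq_zero_iff)
      \<comment> \<open>\<open>e2\<close> lies in the kernel of \<open>f\<close>, and
        \<open>e1\<close> is scaled so that the change of basis has determinant 1, which keeps the
        bracket equal to \<open>x3\<close>.\<close>
      define e1 where "e1 = (f x1 / d) *\<^sub>R x1 + (f x2 / d) *\<^sub>R x2"
      define e2 where "e2 = (- f x2) *\<^sub>R x1 + f x1 *\<^sub>R x2"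
      have dd: "f x1 / d * f x1 + f x2 / d * f x2 = 1"
        using d by (simp add: d_def flip: add_divide_distrib)
      then have "f e1 = 1" "f e2 = 0"
        by (simp_all add: e1_def e2_def linear_add[OF lf] linear_cmul[OF lf] linear_neg[OF lf] linear_diff[OF lf])
      have "is_basis3 e1 e2 x3"
      proof (rule is_basis3I[OF dim])
        fix r s t assume a: "r *\<^sub>R e1 + s *\<^sub>R e2 + t *\<^sub>R x3 = 0"
        have "f (r *\<^sub>R e1 + s *\<^sub>R e2 + t *\<^sub>R x3) = 0" unfolding a by (rule linear_0[OF lf])
        then have r: "r = 0"
          by (simp add: linear_add[OF lf] linear_cmul[OF lf] \<open>f e1 = 1\<close> \<open>f e2 = 0\<close> f3)
        have "(- s * f x2) *\<^sub>R x1 + (s * f x1) *\<^sub>R x2 + t *\<^sub>R x3 = 0"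
          using a r by (simp add: e2_def algebra_simps)
        from is_basis3_indep[OF x this] r False show "r = 0 \<and> s = 0 \<and> t = 0" by auto
      qed
      moreover have "b e1 e2 = 1 *\<^sub>R x3"
        unfolding e1_def e2_def b12 using dd by simp
      moreover have "b e1 x3 = 0" "b e2 x3 = 0"
        using b13[of _ _ 1] by (simp_all only: e1_def e2_def scaleR_one)
      ultimately show thesis using that \<open>f e2 = 0\<close> by blast
    qed
    have z: "\<alpha> e2 = 0" "\<alpha> x3 = 0" "\<gamma> e2 = 0" "\<gamma> x3 = 0" using e f(2) x3 by auto
    have vanish: "g y = 0" if "linear g" "g e1 = 0" "g e2 = 0" "g x3 = 0" for g :: "'g \<Rightarrow> real" and y
    proof -
      obtain r s t where "y = r *\<^sub>R e1 + s *\<^sub>R e2 + t *\<^sub>R x3" by (rule is_basis3_spanE[OF e(1)])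
      then show ?thesis using that by (simp add: linear_add linear_cmul)
    qed
    have e2: "\<beta> e2 = 0" if "\<alpha> e1 = 0" "\<gamma> e1 = 0"
      using f(3) vanish[OF lin(1)] vanish[OF lin(3)] that z e(5) by blast
    obtain k k' where k: "(k, k') \<in> heisenberg_pairs"
      "lie_isomorphic (nf 1 (\<alpha> e1) (\<gamma> e1) (\<beta> e1) (\<beta> e2)) k"
      "lie_isomorphic (nf 1 (\<gamma> e1) (\<alpha> e1) (- \<beta> e1) (- \<beta> e2)) k'"
      using nf_heisenberg_pair[of "\<alpha> e1" "\<gamma> e1" "\<beta> e2" "\<beta> e1"] e2 by auto
    have "lie_isomorphic (semidirect b \<rho>) k"
      using semidirect_isomorphic_std[OF b e(1-4) tr] k(2) lie_isomorphic_trans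
      by (auto simp: nf_def z True)
    moreover have "lie_isomorphic (semidirect b (dual_rep \<rho>)) k'"
      using semidirect_isomorphic_std[OF b e(1-4) w] k(3) lie_isomorphic_trans
      by (auto simp: nf_def z True)
    ultimately show ?thesis using k(1) by blast
  next
    case False
    define d where "d = \<gamma> x1 * \<alpha> x2 - \<gamma> x2 * \<alpha> x1"
    have d: "d \<noteq> 0" using False x3 by (simp add: d_def)
    \<comment> \<open>The basis of the plane dual to \<open>(\<gamma>, \<alpha>)\<close>. Its
      determinant is \<open>1 / d\<close>, so its bracket is \<open>e3\<close>; since
      \<open>\<beta> x3 = d\<close>, the same scaling gives \<open>\<beta> e3 = 1\<close>.\<close>
    define e1 where "e1 = (\<alpha> x2 / d) *\<^sub>R x1 + (- \<alpha> x1 / d) *\<^sub>R x2"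
    define e2 where "e2 = (- \<gamma> x2 / d) *\<^sub>R x1 + (\<gamma> x1 / d) *\<^sub>R x2"
    define e3 where "e3 = (1 / d) *\<^sub>R x3"
    have ev: "\<gamma> e1 = 1" "\<gamma> e2 = 0" "\<alpha> e1 = 0" "\<alpha> e2 = 1"
      using d unfolding e1_def e2_def la lc by (simp_all add: field_simps) (simp_all add: d_def algebra_simps)
    have ev3: "\<alpha> e3 = 0" "\<gamma> e3 = 0" "\<beta> e3 = 1"
      using d x3 by (simp_all add: e3_def la lb lc flip: d_def)
    have B: "is_basis3 e1 e2 e3"
    proof (rule is_basis3I[OF dim])
      fix r s t assume a: "r *\<^sub>R e1 + s *\<^sub>R e2 + t *\<^sub>R e3 = 0"
      have "\<alpha> (r *\<^sub>R e1 + s *\<^sub>R e2 + t *\<^sub>R e3) = 0" "\<gamma> (r *\<^sub>R e1 + s *\<^sub>R e2 + t *\<^sub>R e3) = 0"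
        unfolding a by (simp_all add: la lc)
      then have rs: "r = 0" "s = 0" by (simp_all add: la lc ev ev3)
      have "\<beta> (r *\<^sub>R e1 + s *\<^sub>R e2 + t *\<^sub>R e3) = 0" unfolding a by (simp add: lb)
      then show "r = 0 \<and> s = 0 \<and> t = 0" using rs by (simp add: lb ev3)
    qed
    have "(\<alpha> x2 / d) * (\<gamma> x1 / d) - (- \<alpha> x1 / d) * (- \<gamma> x2 / d) = d / (d * d)"
      by (simp add: d_def diff_divide_distrib mult.commute)
    then have br: "b e1 e2 = 1 *\<^sub>R e3"
      unfolding e1_def e2_def b12 e3_def using d by simp
    have br': "b e1 e3 = 0" "b e2 e3 = 0"
      unfolding e1_def e2_def e3_def b13 by simp_all
    have "lie_isomorphic (semidirect b \<rho>) alg_h19"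
      using lie_isomorphic_trans[OF semidirect_isomorphic_std[OF b B br br' tr, unfolded ev ev3] std_isomorphic_h19] .
    moreover have "lie_isomorphic (semidirect b (dual_rep \<rho>)) alg_h19"
      using lie_isomorphic_trans[OF semidirect_isomorphic_std[OF b B br br' w, unfolded ev ev3] std_isomorphic_h19_dual] .
    ultimately show ?thesis by (auto simp: heisenberg_pairs_def)
  qed
qed

subsection \<open>Invariants\<close>

definition lie_center :: "('g::real_vector \<Rightarrow> 'g \<Rightarrow> 'g) \<Rightarrow> 'g set" where
  "lie_center b = {x. \<forall>y. b x y = 0}"

definition two_step :: "('g::real_vector \<Rightarrow> 'g \<Rightarrow> 'g) \<Rightarrow> bool" where
  "two_step b \<longleftrightarrow> (\<forall>x y z. b x (b y z) = 0)"

definition abelian_hyperplane :: "('g::real_vector \<Rightarrow> 'g \<Rightarrow> 'g) \<Rightarrow> bool" where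
  "abelian_hyperplane b \<longleftrightarrow>
     (\<exists>f :: 'g \<Rightarrow> real. linear f \<and> (\<forall>x y. f x = 0 \<longrightarrow> f y = 0 \<longrightarrow> b x y = 0))"

text \<open>Hyperplanes are pulled back along the isomorphism, so the last claim is one implication;
  \<open>lie_isomorphic_sym\<close> supplies the converse.\<close>

lemma lie_isomorphic_invariants:
  fixes b c :: "real ^ 6 \<Rightarrow> real ^ 6 \<Rightarrow> real ^ 6"
  assumes "lie_isomorphic b c"
  shows "dim (lie_center b) = dim (lie_center c)" "two_step b \<longleftrightarrow> two_step c"
    "abelian_hyperplane c \<Longrightarrow> abelian_hyperplane b"
proof -
  obtain f where f: "linear f" "bij f" "\<And>x y. f (b x y) = c (f x) (f y)"
    using assms by (auto simp: lie_isomorphic_def)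
  have inj: "inj f" and surj: "surj f" using f(2) by (auto simp: bij_def)
  have f0: "f x = 0 \<longleftrightarrow> x = 0" for x using f(1) inj by (metis linear_0 injD)
  have all: "(\<forall>y. P (f y)) \<longleftrightarrow> (\<forall>y. P y)" for P :: "real ^ 6 \<Rightarrow> bool" using surj by (metis surjD)
  have cf: "c (f x) (f y) = 0 \<longleftrightarrow> b x y = 0" for x y by (metis f(3) f0)
  have "x \<in> lie_center b \<longleftrightarrow> f x \<in> lie_center c" for x
    using all[of "\<lambda>y. c (f x) y = 0"] by (simp add: lie_center_def cf)
  then have "f ` lie_center b = lie_center c" using surj by (auto simp: image_iff) (metis surjD)
  then show "dim (lie_center b) = dim (lie_center c)"
    using dim_image_eq[OF f(1), of "lie_center b"] inj by (metis inj_on_subset subset_UNIV)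
  have "two_step c \<longleftrightarrow> (\<forall>x y z. c (f x) (c (f y) (f z)) = 0)"
    unfolding two_step_def by (metis surj surjD)
  then show "two_step b \<longleftrightarrow> two_step c"
    by (simp add: two_step_def f0 flip: f(3))
  assume "abelian_hyperplane c"
  then obtain g :: "_ \<Rightarrow> real" where g: "linear g" "\<And>x y. g x = 0 \<Longrightarrow> g y = 0 \<Longrightarrow> c x y = 0"
    by (auto simp: abelian_hyperplane_def)
  have "\<forall>x y. g (f x) = 0 \<longrightarrow> g (f y) = 0 \<longrightarrow> b x y = 0" using g(2) cf by metis
  then show "abelian_hyperplane b"
    unfolding abelian_hyperplane_def using linear_compose[OF f(1) g(1)] by (auto simp: o_def)
qed

lemmas model_simps = alg_defs lie_of_differentials_def vec_eq_iff forall_6 vector_6 wedge_def axis_def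

lemma lie_center_eqI:
  fixes b :: "real ^ 6 \<Rightarrow> real ^ 6 \<Rightarrow> real ^ 6"
  assumes "\<And>x. (\<forall>i. b x (axis i 1) = 0) \<Longrightarrow> \<forall>i. i \<notin> K \<longrightarrow> x $ i = 0"
    and "\<And>x y. \<forall>i. i \<notin> K \<longrightarrow> x $ i = 0 \<Longrightarrow> b x y = 0"
  shows "dim (lie_center b) = card K"
proof -
  have "lie_center b = {x. \<forall>i. i \<notin> K \<longrightarrow> x $ i = 0}"
    using assms by (auto simp: lie_center_def)
  then show ?thesis using dim_substandard_cart[where 'a = real and d = K] by (simp add: dim_vec_eq)
qed

lemma dim_center:
  "dim (lie_center alg_h3) = 2" "dim (lie_center alg_h4) = 2" "dim (lie_center alg_h6) = 3"
  "dim (lie_center alg_h7) = 3" "dim (lie_center alg_h8) = 4" "dim (lie_center alg_h9) = 2"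
  "dim (lie_center alg_h10) = 2" "dim (lie_center alg_h11) = 2" "dim (lie_center alg_h17) = 3"
  "dim (lie_center alg_h19) = 1"
proof -
  have "dim (lie_center alg_h3) = card {5, 6 :: 6}" "dim (lie_center alg_h4) = card {5, 6 :: 6}"
    "dim (lie_center alg_h6) = card {4, 5, 6 :: 6}" "dim (lie_center alg_h7) = card {4, 5, 6 :: 6}"
    "dim (lie_center alg_h8) = card {1, 4, 5, 6 :: 6}" "dim (lie_center alg_h9) = card {5, 6 :: 6}"
    "dim (lie_center alg_h10) = card {5, 6 :: 6}" "dim (lie_center alg_h11) = card {5, 6 :: 6}"
    "dim (lie_center alg_h17) = card {3, 5, 6 :: 6}" "dim (lie_center alg_h19) = card {6 :: 6}"
    by (rule lie_center_eqI; simp add: model_simps)+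
  then show "dim (lie_center alg_h3) = 2" "dim (lie_center alg_h4) = 2" "dim (lie_center alg_h6) = 3"
    "dim (lie_center alg_h7) = 3" "dim (lie_center alg_h8) = 4" "dim (lie_center alg_h9) = 2"
    "dim (lie_center alg_h10) = 2" "dim (lie_center alg_h11) = 2" "dim (lie_center alg_h17) = 3"
    "dim (lie_center alg_h19) = 1"
    by simp_all
qed

lemma two_step_models:
  "two_step alg_h4" "two_step alg_h6" "two_step alg_h3"
  "\<not> two_step alg_h9" "\<not> two_step alg_h17" "\<not> two_step alg_h10" "\<not> two_step alg_h11"
proof -
  show "two_step alg_h4" "two_step alg_h6" "two_step alg_h3"
    by (simp_all add: two_step_def model_simps)
  \<comment> \<open>In each of these models \<open>de4\<close> is 12 and \<open>de6\<close> contains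
    14, so [e1, [e1, e2]] = e6.\<close>
  have "alg_h9 (axis 1 1) (alg_h9 (axis 1 1) (axis 2 1)) \<noteq> 0"
    "alg_h17 (axis 1 1) (alg_h17 (axis 1 1) (axis 2 1)) \<noteq> 0"
    "alg_h10 (axis 1 1) (alg_h10 (axis 1 1) (axis 2 1)) \<noteq> 0"
    "alg_h11 (axis 1 1) (alg_h11 (axis 1 1) (axis 2 1)) \<noteq> 0"
    by (simp_all add: model_simps)
  then show "\<not> two_step alg_h9" "\<not> two_step alg_h17" "\<not> two_step alg_h10" "\<not> two_step alg_h11"
    unfolding two_step_def by blast+
qed

text \<open>Every two-form in the structure equations of h6 and h10 is divisible by the first
  covector, so the bracket vanishes on its kernel.\<close>

lemma abelian_hyperplane_models: "abelian_hyperplane alg_h6" "abelian_hyperplane alg_h10"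
  unfolding abelian_hyperplane_def
  by (rule exI[of _ "\<lambda>x. x $ 1"]; auto intro!: linearI simp: model_simps)+

text \<open>A hyperplane meets the span of the first three basis vectors in at least a plane, and
  components 4, 5 and 6 of the bracket of two vectors of this span form, up to signs and order,
  their cross product.\<close>

lemma no_abelian_hyperplane:
  fixes b :: "real ^ 6 \<Rightarrow> real ^ 6 \<Rightarrow> real ^ 6"
  assumes "\<And>x y. b x y $ 4 = - wedge 1 2 x y" "\<And>x y. b x y $ 5 = - wedge 1 3 x y"
    "\<And>x y. x $ 4 = 0 \<Longrightarrow> y $ 4 = 0 \<Longrightarrow> b x y $ 6 = wedge 2 3 x y"
  shows "\<not> abelian_hyperplane b"
proof
  assume "abelian_hyperplane b"
  then obtain f :: "real ^ 6 \<Rightarrow> real" where f: "linear f" "\<And>x y. f x = 0 \<Longrightarrow> f y = 0 \<Longrightarrow> b x y = 0"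
    by (auto simp: abelian_hyperplane_def)
  define p q r where "p = f (axis 1 1)" "q = f (axis 2 1)" "r = f (axis 3 1)"
  have k: "f (s *\<^sub>R axis 1 1 + t *\<^sub>R axis 2 1 + u *\<^sub>R axis 3 1) = s * p + t * q + u * r" for s t u
    by (simp add: linear_add[OF f(1)] linear_cmul[OF f(1)] p_q_r_def)
  have *: "s * t' = t * s' \<and> s * u' = u * s' \<and> t * u' = u * t'"
    if "s * p + t * q + u * r = 0" "s' * p + t' * q + u' * r = 0" for s t u s' t' u'
  proof -
    let ?x = "s *\<^sub>R axis 1 1 + t *\<^sub>R axis 2 1 + u *\<^sub>R axis 3 1 :: real ^ 6"
    let ?y = "s' *\<^sub>R axis 1 1 + t' *\<^sub>R axis 2 1 + u' *\<^sub>R axis 3 1 :: real ^ 6"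
    have "b ?x ?y = 0" by (rule f(2)) (use that in \<open>simp_all add: k\<close>)
    then have "wedge 1 2 ?x ?y = 0" "wedge 1 3 ?x ?y = 0" "wedge 2 3 ?x ?y = 0"
      using assms(1,2)[of ?x ?y] assms(3)[of ?x ?y] by (simp_all add: axis_def)
    then show ?thesis by (simp add: wedge_def axis_def)
  qed
  \<comment> \<open>\<open>(q, - p, 0)\<close>, \<open>(r, 0, - p)\<close> and
    \<open>(0, r, - q)\<close> lie in the kernel, and the cross product of each two of them has the
    square of \<open>p\<close>, \<open>q\<close> or \<open>r\<close>, up to sign, as a
    component.\<close>
  have p: "p = 0" using *[of q "- p" 0 r 0 "- p"] by simp
  have q: "q = 0" using *[of q "- p" 0 0 r "- q"] p by simp
  have "r = 0" using *[of r 0 "- p" 0 r "- q"] p q by simp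
  \<comment> \<open>Now \<open>f\<close> vanishes on the first three basis vectors, yet the first
    two do not commute.\<close>
  then show False using *[of 1 0 0 0 1 0] p q by simp
qed

lemma no_abelian_hyperplane_models: "\<not> abelian_hyperplane alg_h7" "\<not> abelian_hyperplane alg_h11"
  by (rule no_abelian_hyperplane; simp add: alg_defs lie_of_differentials_def vector_6 wedge_def)+

section \<open>Uniqueness of the dual model\<close>

text \<open>The centres of h3, h6, h8, h9, h17 have dimensions 2, 3, 4, 2, 3; being two-step
  separates h3 from h9 and h6 from h17.\<close>

lemma abelian_pairs_unique:
  assumes "(k, k') \<in> abelian_pairs" and "(l, l') \<in> abelian_pairs" and "lie_isomorphic k l"
  shows "k' = l'"
  using lie_isomorphic_invariants(1,2)[OF assms(3)] assms(1,2)
  by (auto simp: abelian_pairs_def dim_center two_step_models)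

text \<open>The dimension of the centre isolates h8 and h19. Being two-step separates h4 from h10
  and h11, and an abelian hyperplane separates h6 from h7 and h10 from h11.\<close>

lemma heisenberg_pairs_unique:
  assumes "(k, k') \<in> heisenberg_pairs" and "(l, l') \<in> heisenberg_pairs" and "lie_isomorphic k l"
  shows "k' = l'"
  using lie_isomorphic_invariants[OF assms(3)]
    lie_isomorphic_invariants(3)[OF lie_isomorphic_sym[OF assms(3)]] assms(1,2)
  by (auto simp: heisenberg_pairs_def dim_center two_step_models abelian_hyperplane_models
      no_abelian_hyperplane_models)

section \<open>The classification and its dual statement\<close>

theorem proposition5p1:
  fixes b :: "'g::real_vector \<Rightarrow> 'g \<Rightarrow> 'g"
    and \<rho> :: "'g \<Rightarrow> 'v::real_vector \<Rightarrow> 'v"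
  defines "h \<equiv> semidirect b \<rho>"
    and "h_dual \<equiv> semidirect b (dual_rep \<rho>)"
  assumes "lie_algebra b" and "dim (UNIV :: 'g set) = 3"
    and "lie_representation b \<rho>" and "dim (UNIV :: 'v set) = 3"
    and "lie_nilpotent h" and "\<not> lie_abelian h"
  shows
    "(\<exists>k \<in> {alg_h3, alg_h4, alg_h6, alg_h7, alg_h8, alg_h9, alg_h10, alg_h11, alg_h17, alg_h19}.
        lie_isomorphic h k)
     \<and>
     (lie_abelian b \<longrightarrow>
        (\<exists>k \<in> {alg_h3, alg_h6, alg_h8, alg_h9, alg_h17}. lie_isomorphic h k) \<and>
        (\<forall>(k, k') \<in> {(alg_h3, alg_h6), (alg_h6, alg_h3), (alg_h8, alg_h8), (alg_h9, alg_h9), (alg_h17, alg_h17)}.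
           lie_isomorphic h k \<longrightarrow> lie_isomorphic h_dual k'))
     \<and>
     (\<not> lie_abelian b \<longrightarrow>
        lie_isomorphic b heisenberg \<and>
        (\<exists>k \<in> {alg_h4, alg_h6, alg_h7, alg_h8, alg_h10, alg_h11, alg_h19}.
           lie_isomorphic h k) \<and>
        (\<forall>(k, k') \<in> {(alg_h4, alg_h7), (alg_h6, alg_h6), (alg_h7, alg_h4), (alg_h8, alg_h8), (alg_h10, alg_h10), (alg_h11, alg_h11), (alg_h19, alg_h19)}.
           lie_isomorphic h k \<longrightarrow> lie_isomorphic h_dual k'))"
proof -
  note b = \<open>lie_algebra b\<close> and dims = \<open>dim (UNIV :: 'g set) = 3\<close> \<open>dim (UNIV :: 'v set) = 3\<close>
    and rep = \<open>lie_representation b \<rho>\<close>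
  have bb: "bilinear b" and \<rho>: "bilinear \<rho>"
    using b rep by (auto simp: lie_algebra_def lie_representation_def)
  obtain N where N: "lower_central h N = {0}"
    using \<open>lie_nilpotent h\<close> by (auto simp: lie_nilpotent_def)
  have lc: "h x y \<in> lower_central h (Suc n)" if "y \<in> lower_central h n" for x y n
    using that unfolding lower_central.simps by (intro span_base) blast
  \<comment> \<open>Intersecting the lower central series of \<open>h\<close> with V, and projecting
    it to the acting algebra, gives the descending chains for \<open>\<rho>\<close> and
    \<open>b\<close>; both use brackets with \<open>(x, 0)\<close>.\<close>
  let ?V = "\<lambda>n. {v. (0, v) \<in> lower_central h n}" and ?G = "\<lambda>n. fst ` lower_central h n"
  have V: "\<rho> x v \<in> ?V (Suc n)" if "v \<in> ?V n" for x v n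
    using lc[of "(0, v)" n "(x, 0)"] that
    by (simp add: h_def semidirect_def bilinear_rzero[OF bb] bilinear_lzero[OF \<rho>] del: lower_central.simps)
  have V0: "?V 0 = UNIV" "?V N = {0}" using N by (simp_all add: zero_prod_def)
  obtain v1 v2 v3 \<alpha> \<beta> \<gamma> where tr: "triangular_rep \<rho> v1 v2 v3 \<alpha> \<beta> \<gamma>"
    by (rule triangular_rep_exists[where W = ?V and N = N, OF dims(2) \<rho> V0(1) V V0(2)])
  have G: "b x y \<in> ?G (Suc n)" if y: "y \<in> ?G n" for x y n
  proof -
    obtain z where z: "z \<in> lower_central h n" "y = fst z" using y by blast
    have "fst (h (x, 0) z) = b x y" by (simp add: h_def semidirect_def split_beta z(2))
    then show ?thesis using lc[OF z(1), of "(x, 0)"] by (metis imageI)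
  qed
  have G0: "?G 0 = UNIV" "?G N = {0}" using N by auto
  \<comment> \<open>The claim concerns every listed model isomorphic to \<open>h\<close>: such a
    model is isomorphic to the one found, so both have the same dual.\<close>
  have determined: "lie_isomorphic h_dual l'"
    if "lie_isomorphic h k" "lie_isomorphic h_dual k'" "lie_isomorphic h l" "lie_isomorphic k l \<Longrightarrow> k' = l'"
    for k k' l l' :: "real ^ 6 \<Rightarrow> real ^ 6 \<Rightarrow> real ^ 6"
    using that lie_isomorphic_sym lie_isomorphic_trans by blast
  show ?thesis
  proof (cases "lie_abelian b")
    case True
    obtain k k' where k: "(k, k') \<in> abelian_pairs" "lie_isomorphic h k" "lie_isomorphic h_dual k'"
      using semidirect_abelian[OF b dims(1) rep tr _ True] \<open>\<not> lie_abelian h\<close>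
      unfolding h_def h_dual_def by blast
    have "\<forall>(l, l') \<in> abelian_pairs. lie_isomorphic h l \<longrightarrow> lie_isomorphic h_dual l'"
      using determined[OF k(2,3)] abelian_pairs_unique[OF k(1)] by blast
    moreover have "k \<in> {alg_h3, alg_h6, alg_h8, alg_h9, alg_h17}"
      using k(1) by (auto simp: abelian_pairs_def)
    ultimately show ?thesis
      using True k(2) unfolding abelian_pairs_def by blast
  next
    case False
    obtain x1 x2 x3 where x: "heisenberg_basis b x1 x2 x3"
      by (rule nilpotent_dim3_heisenberg_basis[where W = ?G and N = N, OF b dims(1) False G0(1) G G0(2)])
    obtain k k' where k: "(k, k') \<in> heisenberg_pairs" "lie_isomorphic h k" "lie_isomorphic h_dual k'"
      using semidirect_heisenberg[OF b dims(1) rep tr x] unfolding h_def h_dual_def by blast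
    have "\<forall>(l, l') \<in> heisenberg_pairs. lie_isomorphic h l \<longrightarrow> lie_isomorphic h_dual l'"
      using determined[OF k(2,3)] heisenberg_pairs_unique[OF k(1)] by blast
    moreover have "k \<in> {alg_h4, alg_h6, alg_h7, alg_h8, alg_h10, alg_h11, alg_h19}"
      using k(1) by (auto simp: heisenberg_pairs_def)
    ultimately show ?thesis
      using False k(2) heisenberg_isomorphic[OF x] unfolding heisenberg_pairs_def by blast
  qed
qed

end
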